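(* Let $p \geq 5$ be a prime and let $f \in \mathbb{Q}[x]$ be an irreducible polynomial of degree $p$ over $\mathbb{Q}$ which has a pair of complex (i.e. non-real) roots. If $f$ is solvable by radicals, then $\operatorname{Gal}(f/\mathbb{Q})$, viewed as a permutation group on the $p$ roots of $f$, is a Frobenius group of degree $p$, and $f$ has exactly one real root.
   Context: A Frobenius group is a transitive permutation group which is not regular, but in which only the identity has more than one fixed point; that is, a transitive permutation group $G$ on a set $\Omega$ such that $G_{\alpha} \neq 1$ for some $\alpha \in \Omega$, but $G_{\alpha} \cap G_{\beta} = 1$ for all $\alpha, \beta \in \Omega$ with $\alpha \neq \beta$ (where $G_\alpha$ is the stabilizer of $\alpha$). Its degree is $|\Omega|$. "Complex root" means non-real root. $\operatorname{Gal}(f/\mathbb{Q})$ denotes the Galois group over $\mathbb{Q}$ of the splitting field of $f$ in $\mathbb{C}$, acting on the set of the $p$ roots of $f$. *)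

theory Defs
  imports
    Complex_Main
    "HOL-Computational_Algebra.Polynomial_Factorial"
    "HOL-Algebra.Algebraic_Closure_Type"
    "HOL-Algebra.Generated_Fields"
    "HOL-Algebra.Group_Action"
begin

abbreviation complex_field :: "complex ring" where
  "complex_field \<equiv> ring_of_type_algebra"

definition complex_roots :: "rat poly \<Rightarrow> complex set" where
  "complex_roots f = {z. poly (map_poly of_rat f) z = 0}"

definition splitting_field :: "rat poly \<Rightarrow> complex set" where
  "splitting_field f = generate_field complex_field (\<rat> \<union> complex_roots f)"

text \<open>
  \<^term>\<open>K\<close> and \<^term>\<open>L\<close> are meant to be subfields of \<^term>\<open>R\<close> with
  \<^term>\<open>K \<subseteq> L\<close>. Automorphisms are represented, as in \<^const>\<open>BijGroup\<close>, by functions that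
  are extensional on \<^term>\<open>L\<close>.
\<close>

definition galois_group ::
    "('a, 'b) ring_scheme \<Rightarrow> 'a set \<Rightarrow> 'a set \<Rightarrow> ('a \<Rightarrow> 'a) monoid" where
  "galois_group R K L =
     BijGroup L \<lparr>carrier := {\<sigma> \<in> Bij L.
       \<sigma> \<in> ring_hom (R \<lparr>carrier := L\<rparr>) (R \<lparr>carrier := L\<rparr>) \<and> (\<forall>x\<in>K. \<sigma> x = x)}\<rparr>"

text \<open>
  The final fields of towers
  \<open>K = K\<^sub>0 \<subseteq> K\<^sub>1 \<subseteq> \<dots> \<subseteq> K\<^sub>m\<close> with \<open>K\<^sub>i\<^sub>+\<^sub>1 = K\<^sub>i(\<alpha>)\<close> for some \<open>\<alpha>\<close> having a positive power
  in \<open>K\<^sub>i\<close>. The exponent may vary from step to step and no roots of unity are assumed to lie in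
  \<open>K\<close>.
\<close>

inductive radical_extension :: "('a, 'b) ring_scheme \<Rightarrow> 'a set \<Rightarrow> 'a set \<Rightarrow> bool"
  for R and K where
    base: "radical_extension R K K"
  | adjoin: "\<lbrakk> radical_extension R K L; \<alpha> \<in> carrier R; n > 0; \<alpha> [^]\<^bsub>R\<^esub> (n::nat) \<in> L \<rbrakk>
      \<Longrightarrow> radical_extension R K (generate_field R (insert \<alpha> L))"

text \<open>
  The radical extension only has to contain the splitting field; it need not be equal to it.
\<close>

definition solvable_by_radicals :: "rat poly \<Rightarrow> bool" where
  "solvable_by_radicals f \<longleftrightarrow>
     (\<exists>L. radical_extension complex_field \<rat> L \<and> splitting_field f \<subseteq> L)"

text \<open>A permutation group on \<open>E\<close> is given as a faithful action on \<open>E\<close>.\<close>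

locale frobenius_group = faithful_action G E \<phi> + transitive_action G E \<phi>
  for G (structure) and E and \<phi> +
  assumes ex_nontrivial_stabilizer: "\<exists>\<alpha>\<in>E. stabilizer G \<phi> \<alpha> \<noteq> {\<one>}"
    and stabilizers_Int: "\<lbrakk> \<alpha> \<in> E; \<beta> \<in> E; \<alpha> \<noteq> \<beta> \<rbrakk>
      \<Longrightarrow> stabilizer G \<phi> \<alpha> \<inter> stabilizer G \<phi> \<beta> = {\<one>}"

end

theory Submission
  imports Defs "HOL-Computational_Algebra.Fundamental_Theorem_Algebra"
begin

text \<open>
  Let \<open>\<Omega>\<close> be a normal extension of \<open>\<rat>\<close> containing a radical tower and let \<open>D\<^sub>k\<close> be the derived series
  of \<open>Aut \<Omega>\<close>. Automorphisms commute on roots of unity, so \<open>D\<^sub>1\<close> fixes those; and if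
  \<open>D\<^sub>k\<close> (with \<open>k \<ge> 1\<close>) fixes a field \<open>L\<close> of the tower, its elements multiply a radical \<open>\<alpha>\<close> over \<open>L\<close> by
  roots of unity, hence commute on \<open>\<alpha>\<close>, so \<open>D\<^sub>k\<^sub>+\<^sub>1\<close> fixes \<open>L(\<alpha>)\<close>. Thus the Galois group, being a quotient
  of \<open>Aut \<Omega>\<close>, is solvable. By Galois' theorem on solvable transitive groups of prime degree, an
  automorphism fixing two roots is trivial. Complex conjugation is not trivial, so there is at most
  one real root; as \<open>p\<close> is odd and non-real roots come in pairs, there is one.
\<close>

section \<open>Solvable transitive groups of prime degree\<close>

text \<open>Everything takes place inside the complex numbers. Normality of \<open>gen S\<close>
  means that its embeddings permute the finite set \<open>S\<close>; this stands in for degrees and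
  the Galois correspondence. The arguments rest on two facts: embeddings extend, and a field is
  fixed as soon as its generators are. A radical tower need not be normal and need not contain roots
  of unity. The first derived step is therefore spent on these: once they are fixed, g(z) = u z and
  h(z) = v z with u, v roots of unity give g(h(z)) = u v z = h(g(z)). Each step of the tower asks
  for a larger normal field, so the claim about a derived subgroup is carried for all normal fields
  above a given one. Passing to the Galois group of f works because restriction between normal
  fields is onto, hence maps derived series onto derived series. Complex conjugation serves twice:
  it also fixes the real root, which provides the nontrivial stabilizer of a Frobenius
  group.\<close>

lemma (in group_action) subgroup_fixator:
  assumes "F \<subseteq> E"
  shows "subgroup {g \<in> carrier G. \<forall>x\<in>F. \<phi> g x = x} G"
proof -
  interpret group G using group_hom group_hom.axioms(1) by auto
  show ?thesis
  proof (rule subgroupI)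
    have "\<phi> \<one> x = x" if "x \<in> F" for x using that assms id_eq_one by (metis restrict_apply' subsetD)
    then show "{g \<in> carrier G. \<forall>x\<in>F. \<phi> g x = x} \<noteq> {}" by blast
  qed (use assms composition_rule orbit_sym_aux in auto)
qed

text \<open>\<open>H\<close> acts on \<open>F\<close> through an abelian quotient, whose kernel
  contains every commutator. Commutation is asked on \<open>F\<close> only, since elsewhere in
  \<open>E\<close> it may fail; this form serves both roots of unity and radicals.\<close>

lemma (in group_action) derived_fixes:
  assumes H: "subgroup H G" and "F \<subseteq> E" and stable: "\<And>h x. h \<in> H \<Longrightarrow> x \<in> F \<Longrightarrow> \<phi> h x \<in> F"
    and comm: "\<And>g h x. g \<in> H \<Longrightarrow> h \<in> H \<Longrightarrow> x \<in> F \<Longrightarrow> \<phi> g (\<phi> h x) = \<phi> h (\<phi> g x)"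
    and "g \<in> derived G H" "x \<in> F"
  shows "\<phi> g x = x"
proof -
  interpret group G using group_hom group_hom.axioms(1) by auto
  have "derived G H \<subseteq> {g \<in> carrier G. \<forall>x\<in>F. \<phi> g x = x}"
    unfolding derived_def
  proof (rule generate_subgroup_incl[OF _ subgroup_fixator[OF \<open>F \<subseteq> E\<close>]], safe)
    fix g h assume gh: "g \<in> H" "h \<in> H"
    then have ghc: "g \<in> carrier G" "h \<in> carrier G" using H subgroup.mem_carrier by fast+
    show "g \<otimes> h \<otimes> inv g \<otimes> inv h \<in> carrier G" using ghc by simp
    fix x assume x: "x \<in> F"
    \<comment> \<open>With v = g^-1 h^-1 x the commutator sends x to g h v = h g v = h u = x;
      stability of \<open>F\<close> puts v where commutation is known.\<close>
    define u where "u = \<phi> (inv h) x"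
    define v where "v = \<phi> (inv g) u"
    have u: "u \<in> F" unfolding u_def using gh x stable subgroup.m_inv_closed[OF H] by blast
    have v: "v \<in> F" unfolding v_def using gh u stable subgroup.m_inv_closed[OF H] by blast
    have "\<phi> g v = u" "\<phi> h u = x"
      using orbit_sym_aux[of "inv g" u v] orbit_sym_aux[of "inv h" x u] ghc u x \<open>F \<subseteq> E\<close>
      by (auto simp: u_def v_def)
    moreover have "\<phi> (g \<otimes> h \<otimes> inv g \<otimes> inv h) x = \<phi> g (\<phi> h v)"
      using ghc u v x \<open>F \<subseteq> E\<close> by (auto simp: composition_rule u_def v_def subset_iff)
    ultimately show "\<phi> (g \<otimes> h \<otimes> inv g \<otimes> inv h) x = x" using comm[OF gh v] by simp
  qed
  with assms show ?thesis by blast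
qed

text \<open>Since h t = t (t^-1 h t), the point h t x lies in t H x. One inclusion suffices, because
  orbit sizes are later compared in both directions.\<close>

lemma (in group_action) orbit_image_normalized:
  assumes H: "subgroup H G" and t: "t \<in> carrier G" and "x \<in> E"
    and norm: "\<And>h. h \<in> H \<Longrightarrow> inv t \<otimes> h \<otimes> t \<in> H"
  shows "orbit (G\<lparr>carrier := H\<rparr>) \<phi> (\<phi> t x) \<subseteq> \<phi> t ` orbit (G\<lparr>carrier := H\<rparr>) \<phi> x"
proof
  interpret group G using group_hom group_hom.axioms(1) by auto
  fix y assume "y \<in> orbit (G\<lparr>carrier := H\<rparr>) \<phi> (\<phi> t x)"
  then obtain h where h: "h \<in> H" and y: "y = \<phi> h (\<phi> t x)" by (auto simp: orbit_def)
  have hc: "h \<in> carrier G" using H h by (rule subgroup.mem_carrier)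
  have "h \<otimes> t = t \<otimes> (inv t \<otimes> h \<otimes> t)" using hc t by (simp flip: m_assoc)
  then have "y = \<phi> t (\<phi> (inv t \<otimes> h \<otimes> t) x)"
    using y composition_rule[OF \<open>x \<in> E\<close>] hc t by (metis inv_closed m_closed)
  then show "y \<in> \<phi> t ` orbit (G\<lparr>carrier := H\<rparr>) \<phi> x"
    using norm[OF h] by (auto simp: orbit_def)
qed

text \<open>The orbits of \<open>H\<close> are permuted transitively by \<open>T\<close>, so they have the same size, which
  divides the prime \<^term>\<open>card E\<close>.\<close>

lemma (in group_action) normalized_subgroup_transitive:
  assumes H: "subgroup H G" and T: "T \<subseteq> carrier G"
    and trans: "\<And>x y. x \<in> E \<Longrightarrow> y \<in> E \<Longrightarrow> \<exists>t\<in>T. \<phi> t x = y"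
    and norm: "\<And>t h. t \<in> T \<Longrightarrow> h \<in> H \<Longrightarrow> inv t \<otimes> h \<otimes> t \<in> H"
    and prime: "Factorial_Ring.prime (card E)"
    and h0: "h0 \<in> H" "x0 \<in> E" "\<phi> h0 x0 \<noteq> x0"
    and xy: "x \<in> E" "y \<in> E"
  shows "\<exists>h\<in>H. \<phi> h x = y"
proof -
  interpret H: group_action "G\<lparr>carrier := H\<rparr>" E \<phi> by (rule induced_action[OF H])
  let ?orb = "orbit (G\<lparr>carrier := H\<rparr>) \<phi>"
  have fin: "finite E" using prime by (cases "finite E") auto
  have sub: "?orb x \<subseteq> E" if "x \<in> E" for x
    using H.element_image that by (auto simp: orbit_def)
  \<comment> \<open>Exchanging the two points turns this inequality into equality of all orbit
    sizes.\<close>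
  have le: "card (?orb y) \<le> card (?orb x)" if xy: "x \<in> E" "y \<in> E" for x y
  proof -
    obtain t where t: "t \<in> T" "\<phi> t x = y" using trans[OF xy] by blast
    then have "?orb y \<subseteq> \<phi> t ` ?orb x"
      using orbit_image_normalized[OF H _ xy(1), of t] norm T by blast
    moreover have "finite (?orb x)" using sub[OF xy(1)] fin by (rule finite_subset)
    ultimately show ?thesis by (meson card_image_le card_mono finite_imageI order_trans)
  qed
  have "card (?orb x) * card (orbits (G\<lparr>carrier := H\<rparr>) E \<phi>) = card (\<Union> (orbits (G\<lparr>carrier := H\<rparr>) E \<phi>))"
  proof (rule card_partition)
    show "finite (orbits (G\<lparr>carrier := H\<rparr>) E \<phi>)" using fin by (simp add: orbits_def)
    show "finite (\<Union> (orbits (G\<lparr>carrier := H\<rparr>) E \<phi>))" using fin by (simp add: H.orbits_coverture)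
    show "card c = card (?orb x)" if "c \<in> orbits (G\<lparr>carrier := H\<rparr>) E \<phi>" for c
      using that le xy(1) by (auto simp: orbits_def intro!: antisym)
    show "c1 \<inter> c2 = {}" if "c1 \<in> orbits (G\<lparr>carrier := H\<rparr>) E \<phi>" "c2 \<in> orbits (G\<lparr>carrier := H\<rparr>) E \<phi>"
      "c1 \<noteq> c2" for c1 c2
      using H.disjoint_union that by blast
  qed
  then have "card (?orb x) dvd card E" unfolding H.orbits_coverture by (metis dvd_triv_left)
  then have "card (?orb x) = 1 \<or> card (?orb x) = card E" using prime by (simp add: prime_nat_iff)
  moreover have "card (?orb x) \<noteq> 1"
  proof
    assume "card (?orb x) = 1"
    then have "card (?orb x0) = 1" using le h0(2) xy(1) by (metis le_antisym)
    then obtain z where "?orb x0 = {z}" by (rule card_1_singletonE)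
    moreover have "x0 \<in> ?orb x0" using h0(2) by (rule H.orbit_refl)
    moreover have "\<phi> h0 x0 \<in> ?orb x0" using h0(1) by (auto simp: orbit_def)
    ultimately show False using h0(3) by simp
  qed
  ultimately have "?orb x = E" using sub[OF xy(1)] fin by (simp add: card_subset_eq)
  then show ?thesis using xy(2) by (auto simp: orbit_def)
qed

lemma (in faithful_action) eq_one_if_fixes_all:
  assumes g: "g \<in> carrier G" and fixes_all: "\<And>x. x \<in> E \<Longrightarrow> \<phi> g x = x"
  shows "g = \<one>"
proof -
  interpret group G using group_hom group_hom.axioms(1) by auto
  have "\<phi> g = \<phi> \<one>"
    unfolding id_eq_one[symmetric]
    using Bij_imp_extensional[OF bij_prop0[OF g]] fixes_all by (intro extensionalityI[of _ E]) auto
  with faithful show ?thesis using g by (simp add: inj_on_eq_iff)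
qed

text \<open>Galois: let \<open>A\<close> be the last nontrivial term of the derived series. It is abelian and
  transitive, hence regular. If \<open>\<sigma>\<close> fixes \<open>a\<close> and \<open>b\<close> and \<open>\<tau> \<in> A\<close> maps \<open>a\<close> to \<open>b\<close>, then
  \<open>\<sigma>\<close> commutes with \<open>\<tau>\<close>; so the centralizer of \<open>\<sigma>\<close> in \<open>A\<close> is nontrivial and therefore transitive.\<close>

theorem solvable_prime_degree_stabilizers:
  fixes G (structure)
  assumes "faithful_action G E \<phi>" "transitive_action G E \<phi>"
    and prime: "Factorial_Ring.prime (card E)"
    and solvable: "(derived G ^^ n) (carrier G) = {\<one>}"
    and ab: "a \<in> E" "b \<in> E" "a \<noteq> b"
  shows "stabilizer G \<phi> a \<inter> stabilizer G \<phi> b = {\<one>}"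
proof -
  interpret faithful_action G E \<phi> by fact
  interpret transitive_action G E \<phi> by fact
  interpret group G using group_hom group_hom.axioms(1) by auto
  define m where "m = (LEAST m. (derived G ^^ m) (carrier G) = {\<one>})"
  have m: "(derived G ^^ m) (carrier G) = {\<one>}"
    unfolding m_def using solvable by (rule LeastI)
  have "m \<noteq> 0"
  proof
    assume "m = 0"
    then have "carrier G = {\<one>}" using m by simp
    moreover obtain g where "g \<in> carrier G" "\<phi> g a = b" using unique_orbit ab by blast
    ultimately have "\<phi> \<one> a = b" by simp
    then show False using ab id_eq_one by (metis restrict_apply')
  qed
  then obtain k where k: "m = Suc k" using not0_implies_Suc by blast
  define A where "A = (derived G ^^ k) (carrier G)"
  \<comment> \<open>Minimality of \<open>m\<close> is what makes the preceding term
    nontrivial.\<close>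
  have "A \<noteq> {\<one>}" 
    using not_less_Least[of k "\<lambda>m. (derived G ^^ m) (carrier G) = {\<one>}"] k
    unfolding A_def m_def[symmetric] by simp
  have derA: "derived G A = {\<one>}" using m k by (simp add: A_def)
  have "(derived G ^^ i) (carrier G) \<lhd> G" for i
    by (induction i) (simp_all add: normal_self derived_is_normal)
  then interpret A: normal A G by (simp add: A_def)
  have comm: "g \<otimes> h = h \<otimes> g" if "g \<in> A" "h \<in> A" for g h
  proof -
    have gh: "g \<in> carrier G" "h \<in> carrier G" using that A.subset by auto
    have "g \<otimes> h \<otimes> inv g \<otimes> inv h \<in> derived G A"
      unfolding derived_def using that by (intro generate.incl) blast
    then have "g \<otimes> h \<otimes> inv (h \<otimes> g) = \<one>" using gh derA by (simp add: m_assoc inv_mult_group)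
    then show ?thesis using gh by (metis inv_closed inv_equality inv_inv m_closed)
  qed
  obtain h0 where h0: "h0 \<in> A" "h0 \<noteq> \<one>" using \<open>A \<noteq> {\<one>}\<close> A.one_closed by blast
  then obtain x0 where x0: "x0 \<in> E" "\<phi> h0 x0 \<noteq> x0"
    using eq_one_if_fixes_all[of h0] A.subset by blast
  \<comment> \<open>The orbit criterion is used with \<open>T\<close> the whole group, which
    normalizes \<open>A\<close>; faithfulness has supplied the moved point
    \<open>x0\<close>.\<close>
  have Atrans: "\<exists>h\<in>A. \<phi> h x = y" if "x \<in> E" "y \<in> E" for x y
    using normalized_subgroup_transitive[OF A.subgroup_axioms subset_refl unique_orbit _ prime h0(1) x0 that]
      A.inv_op_closed1 by blast
  have Areg: "c = \<one>" if c: "c \<in> A" "\<phi> c a = a" for c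
  proof (rule eq_one_if_fixes_all)
    fix x assume "x \<in> E"
    then obtain h where h: "h \<in> A" "\<phi> h a = x" using Atrans ab by blast
    then show "\<phi> c x = x"
      using comm[OF c(1) h(1)] composition_rule[OF ab(1)] c A.subset by (metis subset_iff)
  qed (use c A.subset in auto)
  have "\<sigma> = \<one>" if \<sigma>: "\<sigma> \<in> carrier G" "\<phi> \<sigma> a = a" "\<phi> \<sigma> b = b" for \<sigma>
  proof -
    obtain \<tau> where \<tau>: "\<tau> \<in> A" "\<phi> \<tau> a = b" using Atrans ab by blast
    then have \<tau>c: "\<tau> \<in> carrier G" using A.subset by auto
    \<comment> \<open>Both \<tau> and its conjugate by \<sigma> lie in \<open>A\<close> and map a to
      b, as \<sigma> fixes both points; regularity of \<open>A\<close> makes them equal.\<close>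
    have "inv \<tau> \<otimes> (\<sigma> \<otimes> \<tau> \<otimes> inv \<sigma>) = \<one>"
    proof (rule Areg)
      show "inv \<tau> \<otimes> (\<sigma> \<otimes> \<tau> \<otimes> inv \<sigma>) \<in> A"
        using \<tau> \<sigma> by (intro A.m_closed A.m_inv_closed A.inv_op_closed2)
      have "\<phi> (inv \<sigma>) a = a" "\<phi> (inv \<tau>) b = a"
        using orbit_sym_aux \<sigma> \<tau> \<tau>c ab by blast+
      then show "\<phi> (inv \<tau> \<otimes> (\<sigma> \<otimes> \<tau> \<otimes> inv \<sigma>)) a = a"
        using \<sigma> \<tau> \<tau>c by (simp add: composition_rule ab)
    qed
    then have "\<sigma> \<otimes> \<tau> \<otimes> inv \<sigma> = \<tau>"
      using \<sigma> \<tau>c by (metis inv_closed inv_equality inv_inv m_closed inv_comm)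
    then have \<sigma>\<tau>: "\<sigma> \<otimes> \<tau> = \<tau> \<otimes> \<sigma>" using \<sigma>(1) \<tau>c by (metis inv_solve_right m_closed)
    define H where "H = {h \<in> A. \<sigma> \<otimes> h = h \<otimes> \<sigma>}"
    have H: "subgroup H G"
    proof (rule subgroupI)
      show "H \<subseteq> carrier G" using A.subset by (auto simp: H_def)
      have "\<one> \<in> H" using \<sigma>(1) by (simp add: H_def)
      then show "H \<noteq> {}" by blast
      fix h assume "h \<in> H"
      then have h: "h \<in> A" "h \<in> carrier G" "\<sigma> \<otimes> h = h \<otimes> \<sigma>" using A.subset by (auto simp: H_def)
      have "\<sigma> \<otimes> inv h = inv h \<otimes> \<sigma>"
        using h \<sigma>(1) by (metis inv_closed inv_solve_left inv_solve_right m_assoc m_closed)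
      then show "inv h \<in> H" using h A.m_inv_closed by (simp add: H_def)
      fix g assume "g \<in> H"
      then have g: "g \<in> A" "g \<in> carrier G" "\<sigma> \<otimes> g = g \<otimes> \<sigma>" using A.subset by (auto simp: H_def)
      have "\<sigma> \<otimes> (h \<otimes> g) = (h \<otimes> g) \<otimes> \<sigma>"
        using h g \<sigma>(1) by (metis m_assoc)
      then show "h \<otimes> g \<in> H" using h g A.m_closed by (simp add: H_def)
    qed
    \<comment> \<open>The orbit criterion is applied again, now with \<open>T\<close> equal to
      \<open>A\<close>: being abelian, \<open>A\<close> normalizes the centralizer \<open>H\<close>
      trivially.\<close>
    have norm: "inv t \<otimes> h \<otimes> t \<in> H" if "t \<in> A" "h \<in> H" for t h
    proof -
      have "h \<in> A" "t \<in> carrier G" "h \<in> carrier G" using that A.subset by (auto simp: H_def)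
      then have "inv t \<otimes> h \<otimes> t = h" using comm[OF that(1)] by (metis inv_solve_left m_assoc m_closed inv_closed)
      with that show ?thesis by simp
    qed
    have "\<tau> \<in> H" using \<tau> \<sigma>\<tau> by (simp add: H_def)
    show ?thesis
    proof (rule eq_one_if_fixes_all[OF \<sigma>(1)])
      fix x assume "x \<in> E"
      obtain h where h: "h \<in> H" "\<phi> h a = x"
        using normalized_subgroup_transitive[OF H A.subset Atrans norm prime \<open>\<tau> \<in> H\<close> ab(1) _ ab(1) \<open>x \<in> E\<close>]
          \<tau>(2) ab(3) by auto
      then have "h \<in> carrier G" "\<sigma> \<otimes> h = h \<otimes> \<sigma>" using A.subset by (auto simp: H_def)
      \<comment> \<open>\<sigma> x = \<sigma> h a = h \<sigma> a = h a = x.\<close>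
      then show "\<phi> \<sigma> x = x" using composition_rule[OF ab(1)] \<sigma>(1,2) h(2) by metis
    qed
  qed
  then show ?thesis
    using stabilizer_one_closed[OF ab(1)] stabilizer_one_closed[OF ab(2)]
    by (auto simp: stabilizer_def)
qed


section \<open>Subfields of the complex numbers\<close>

lemma complex_field_simps [simp]:
  "carrier complex_field = UNIV"
  "x \<oplus>\<^bsub>complex_field\<^esub> y = x + y"
  "x \<otimes>\<^bsub>complex_field\<^esub> y = x * y"
  "\<one>\<^bsub>complex_field\<^esub> = 1"
  "\<zero>\<^bsub>complex_field\<^esub> = 0"
  by (simp_all add: ring_of_type_algebra_def)

lemma field_complex_field: "field complex_field"
  by (rule field_from_type_algebra)

lemmas ring_complex_field = cring.axioms(1)[OF fieldE(1)[OF field_complex_field]]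

lemma complex_field_a_inv [simp]: "\<ominus>\<^bsub>complex_field\<^esub> x = - x"
  by (rule abelian_group.minus_equality[OF ring.axioms(1)[OF ring_complex_field]]) simp_all

lemma complex_field_m_inv [simp]: "x \<noteq> 0 \<Longrightarrow> inv\<^bsub>complex_field\<^esub> x = inverse x"
  by (rule comm_monoid.comm_inv_char[OF cring.axioms(2)[OF fieldE(1)[OF field_complex_field]]]) simp_all

lemma complex_field_nat_pow [simp]: "x [^]\<^bsub>complex_field\<^esub> (n::nat) = x ^ n"
  by (induction n) (simp_all add: mult.commute)

lemma subfield_complexI:
  assumes "1 \<in> K" "\<And>x y. x \<in> K \<Longrightarrow> y \<in> K \<Longrightarrow> x + y \<in> K" "\<And>x y. x \<in> K \<Longrightarrow> y \<in> K \<Longrightarrow> x * y \<in> K"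
    "\<And>x. x \<in> K \<Longrightarrow> - x \<in> K" "\<And>x. x \<in> K \<Longrightarrow> x \<noteq> 0 \<Longrightarrow> inverse x \<in> K"
  shows "subfield K complex_field"
proof (rule field.subfieldI'[OF field_complex_field])
  show "subring K complex_field"
    using assms by (intro ring.subringI[OF ring_complex_field]) auto
qed (use assms in auto)

lemma
  assumes "subfield K complex_field"
  shows subfield_complex_0: "0 \<in> K" and subfield_complex_1: "1 \<in> K"
    and subfield_complex_add: "x \<in> K \<Longrightarrow> y \<in> K \<Longrightarrow> x + y \<in> K"
    and subfield_complex_mult: "x \<in> K \<Longrightarrow> y \<in> K \<Longrightarrow> x * y \<in> K"
    and subfield_complex_uminus: "x \<in> K \<Longrightarrow> - x \<in> K"
    and subfield_complex_inverse: "x \<in> K \<Longrightarrow> inverse x \<in> K"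
proof -
  note K = subringE[OF subfieldE(1)[OF assms]]
  show "0 \<in> K" "1 \<in> K" using K(2,3) by simp_all
  show "x \<in> K \<Longrightarrow> y \<in> K \<Longrightarrow> x + y \<in> K" "x \<in> K \<Longrightarrow> y \<in> K \<Longrightarrow> x * y \<in> K"
    using K(6,7)[of x y] by simp_all
  show "x \<in> K \<Longrightarrow> - x \<in> K" using K(5)[of x] by simp
  show "x \<in> K \<Longrightarrow> inverse x \<in> K"
    using ring.subfield_m_inv(1)[OF ring_complex_field assms, of x] \<open>0 \<in> K\<close> by (cases "x = 0") simp_all
qed

lemmas subfield_complex_closed = subfield_complex_0 subfield_complex_1 subfield_complex_add
  subfield_complex_mult subfield_complex_uminus subfield_complex_inverse

lemma subfield_complex_diff: "subfield K complex_field \<Longrightarrow> x \<in> K \<Longrightarrow> y \<in> K \<Longrightarrow> x - y \<in> K"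
  using subfield_complex_add[of K x "- y"] subfield_complex_uminus[of K y] by simp

lemma subfield_complex_divide: "subfield K complex_field \<Longrightarrow> x \<in> K \<Longrightarrow> y \<in> K \<Longrightarrow> x / y \<in> K"
  by (simp add: divide_inverse subfield_complex_closed)

lemma subfield_complex_power: "subfield K complex_field \<Longrightarrow> x \<in> K \<Longrightarrow> x ^ n \<in> K"
  by (induction n) (simp_all add: subfield_complex_closed)

lemma subfield_complex_sum:
  "subfield K complex_field \<Longrightarrow> (\<And>i. i \<in> I \<Longrightarrow> g i \<in> K) \<Longrightarrow> sum g I \<in> K"
  by (induction I rule: infinite_finite_induct) (simp_all add: subfield_complex_closed)

lemma Rats_subset_subfield:
  assumes "subfield K complex_field"
  shows "\<rat> \<subseteq> K"
proof
  have nat: "of_nat n \<in> K" for n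
    by (induction n) (use assms in \<open>simp_all add: subfield_complex_closed\<close>)
  fix x :: complex assume "x \<in> \<rat>"
  then obtain a b :: int where "x = of_int a / of_int b" by (elim Rats_cases') 
  moreover have "of_int a \<in> K" for a :: int
    by (cases a rule: int_diff_cases) (use assms nat in \<open>simp add: subfield_complex_diff\<close>)
  ultimately show "x \<in> K" using assms by (simp add: subfield_complex_divide)
qed

abbreviation gen :: "complex set \<Rightarrow> complex set" where
  "gen \<equiv> generate_field complex_field"

lemma subfield_gen: "subfield (gen S) complex_field"
  by (rule field.generate_field_is_subfield[OF field_complex_field]) simp

lemma gen_least: "subfield K complex_field \<Longrightarrow> S \<subseteq> K \<Longrightarrow> gen S \<subseteq> K"
  by (rule field.generate_field_min_subfield1[OF field_complex_field]) simp_all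

lemma gen_superset: "S \<subseteq> gen S"
  by (auto intro: generate_field.incl)

lemma gen_mono: "S \<subseteq> T \<Longrightarrow> gen S \<subseteq> gen T"
  using gen_superset[of T] by (intro gen_least subfield_gen) auto

lemma gen_subset_gen: "S \<subseteq> gen T \<Longrightarrow> gen S \<subseteq> gen T"
  by (intro gen_least subfield_gen)


section \<open>Embeddings of subfields of the complex numbers\<close>

text \<open>Values outside \<open>K\<close> are left free, so an embedding of a field is literally
  an embedding of each of its subfields, without any restriction map.\<close>

abbreviation embeddings :: "complex set \<Rightarrow> (complex \<Rightarrow> complex) set" where
  "embeddings K \<equiv> ring_hom (complex_field\<lparr>carrier := K\<rparr>) complex_field"

lemma embeddings_iff:
  "\<sigma> \<in> embeddings K \<longleftrightarrow>
     \<sigma> 1 = 1 \<and> (\<forall>x\<in>K. \<forall>y\<in>K. \<sigma> (x + y) = \<sigma> x + \<sigma> y \<and> \<sigma> (x * y) = \<sigma> x * \<sigma> y)"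
  by (auto simp: ring_hom_def)

context
  fixes K \<sigma>
  assumes K: "subfield K complex_field" and \<sigma>: "\<sigma> \<in> embeddings K"
begin

lemma embedding_1: "\<sigma> 1 = 1"
  and embedding_add: "x \<in> K \<Longrightarrow> y \<in> K \<Longrightarrow> \<sigma> (x + y) = \<sigma> x + \<sigma> y"
  and embedding_mult: "x \<in> K \<Longrightarrow> y \<in> K \<Longrightarrow> \<sigma> (x * y) = \<sigma> x * \<sigma> y"
  using \<sigma> by (auto simp: embeddings_iff)

lemma embedding_0: "\<sigma> 0 = 0"
  using embedding_add[OF subfield_complex_0[OF K] subfield_complex_0[OF K]] by simp

lemma embedding_uminus: "x \<in> K \<Longrightarrow> \<sigma> (- x) = - \<sigma> x"
  using embedding_add[of x "- x"] K embedding_0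
  by (simp add: subfield_complex_uminus eq_neg_iff_add_eq_0 add.commute)

lemma embedding_diff: "x \<in> K \<Longrightarrow> y \<in> K \<Longrightarrow> \<sigma> (x - y) = \<sigma> x - \<sigma> y"
  using embedding_add[of x "- y"] K embedding_uminus by (simp add: subfield_complex_uminus)

lemma embedding_power: "x \<in> K \<Longrightarrow> \<sigma> (x ^ n) = \<sigma> x ^ n"
  using K by (induction n) (simp_all add: embedding_1 embedding_mult subfield_complex_power)

lemma embedding_sum: "(\<And>i. i \<in> I \<Longrightarrow> g i \<in> K) \<Longrightarrow> \<sigma> (sum g I) = (\<Sum>i\<in>I. \<sigma> (g i))"
  using K by (induction I rule: infinite_finite_induct)
    (simp_all add: embedding_0 embedding_add subfield_complex_sum)

lemma embedding_inverse: "x \<in> K \<Longrightarrow> \<sigma> (inverse x) = inverse (\<sigma> x)"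
proof (cases "x = 0")
  case False
  assume "x \<in> K"
  then have "\<sigma> x * \<sigma> (inverse x) = \<sigma> (x * inverse x)"
    using embedding_mult subfield_complex_inverse[OF K] by simp
  then have "\<sigma> x * \<sigma> (inverse x) = 1" using False embedding_1 by simp
  then show ?thesis by (rule inverse_unique[symmetric])
qed (simp add: embedding_0)

lemma embedding_eq_0_iff: "x \<in> K \<Longrightarrow> \<sigma> x = 0 \<longleftrightarrow> x = 0"
  using embedding_mult[of x "inverse x", OF _ subfield_complex_inverse[OF K]] embedding_0 embedding_1
  by (metis mult_zero_left right_inverse zero_neq_one)

lemma inj_on_embedding: "inj_on \<sigma> K"
proof (rule inj_onI)
  fix x y assume "x \<in> K" "y \<in> K" "\<sigma> x = \<sigma> y"
  then have "\<sigma> (x - y) = 0" using embedding_diff by simp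
  then show "x = y" using embedding_eq_0_iff subfield_complex_diff[OF K] \<open>x \<in> K\<close> \<open>y \<in> K\<close> by simp
qed

lemma subfield_embedding_image:
  assumes L: "subfield L complex_field" "L \<subseteq> K"
  shows "subfield (\<sigma> ` L) complex_field"
proof (rule subfield_complexI)
  note closed = subfield_complex_closed[OF L(1)]
  show "1 \<in> \<sigma> ` L" using closed(2) embedding_1 by (metis imageI)
  fix x assume "x \<in> \<sigma> ` L"
  then obtain a where a: "a \<in> L" "a \<in> K" and x: "x = \<sigma> a" using L(2) by blast
  show "- x \<in> \<sigma> ` L" "inverse x \<in> \<sigma> ` L"
    unfolding x embedding_uminus[OF a(2), symmetric] embedding_inverse[OF a(2), symmetric]
    by (intro imageI closed a)+
  fix y assume "y \<in> \<sigma> ` L"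
  then obtain b where b: "b \<in> L" "b \<in> K" and y: "y = \<sigma> b" using L(2) by blast
  show "x + y \<in> \<sigma> ` L" "x * y \<in> \<sigma> ` L"
    unfolding x y embedding_add[OF a(2) b(2), symmetric] embedding_mult[OF a(2) b(2), symmetric]
    by (intro imageI closed a b)+
qed

text \<open>This reduces fixing a generated field to fixing its generators, and shows that the
  rationals are always fixed.\<close>

lemma subfield_embedding_fixed: "subfield {x \<in> K. \<sigma> x = x} complex_field"
  using K by (intro subfield_complexI)
    (auto simp: subfield_complex_closed embedding_1 embedding_add embedding_mult embedding_uminus embedding_inverse)

lemma embedding_of_rat: "\<sigma> (of_rat q) = of_rat q"
  using Rats_subset_subfield[OF subfield_embedding_fixed] Rats_of_rat[of q] by blast

text \<open>Images and preimages of subfields are subfields, so each inclusion is an instance of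
  minimality of \<open>gen\<close>.\<close>

lemma embedding_image_gen:
  assumes "S \<subseteq> K"
  shows "\<sigma> ` gen S = gen (\<sigma> ` S)"
proof
  have SK: "gen S \<subseteq> K" using assms K by (rule gen_least[rotated])
  show "gen (\<sigma> ` S) \<subseteq> \<sigma> ` gen S"
    by (intro gen_least subfield_embedding_image subfield_gen SK image_mono gen_superset)
  have "subfield {x \<in> K. \<sigma> x \<in> gen (\<sigma> ` S)} complex_field"
    using K subfield_gen[of "\<sigma> ` S"] by (intro subfield_complexI)
      (auto simp: subfield_complex_closed embedding_1 embedding_add embedding_mult embedding_uminus embedding_inverse)
  moreover have "S \<subseteq> {x \<in> K. \<sigma> x \<in> gen (\<sigma> ` S)}"
    using assms by (auto intro: generate_field.incl)
  ultimately show "\<sigma> ` gen S \<subseteq> gen (\<sigma> ` S)"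
    using gen_least by blast
qed

end

lemma embeddings_mono: "\<sigma> \<in> embeddings L \<Longrightarrow> K \<subseteq> L \<Longrightarrow> \<sigma> \<in> embeddings K"
  unfolding embeddings_iff by blast

lemma embedding_eq_on_gen:
  assumes "\<sigma> \<in> embeddings (gen S)" "\<tau> \<in> embeddings (gen S)" "\<And>x. x \<in> S \<Longrightarrow> \<sigma> x = \<tau> x" "x \<in> gen S"
  shows "\<sigma> x = \<tau> x"
proof -
  have "subfield {x \<in> gen S. \<sigma> x = \<tau> x} complex_field"
    using subfield_gen[of S] assms(1,2) by (intro subfield_complexI)
      (auto simp: subfield_complex_closed embedding_1 embedding_add embedding_mult embedding_uminus embedding_inverse)
  moreover have "S \<subseteq> {x \<in> gen S. \<sigma> x = \<tau> x}"
    using assms(3) by (auto intro: generate_field.incl)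
  ultimately show ?thesis using gen_least assms(4) by blast
qed


section \<open>Extending embeddings\<close>

text \<open>Complex polynomials with constrained coefficients: degree and evaluation stay those of
  one type, and enlarging \<open>K\<close> is mere inclusion.\<close>

definition polys_over :: "complex set \<Rightarrow> complex poly set" where
  "polys_over K = {p. \<forall>i. Polynomial.coeff p i \<in> K}"

definition algebraic_over :: "complex set \<Rightarrow> complex \<Rightarrow> bool" where
  "algebraic_over K \<alpha> \<longleftrightarrow> (\<exists>p\<in>polys_over K. p \<noteq> 0 \<and> poly p \<alpha> = 0)"

lemma algebraic_over_mono: "algebraic_over K \<alpha> \<Longrightarrow> K \<subseteq> L \<Longrightarrow> algebraic_over L \<alpha>"
  unfolding algebraic_over_def polys_over_def by blast

lemma map_poly_of_rat_polys_over:
  assumes "subfield K complex_field"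
  shows "map_poly of_rat p \<in> polys_over K"
  using Rats_subset_subfield[OF assms] by (auto simp: polys_over_def coeff_map_poly)

context
  fixes K assumes K: "subfield K complex_field"
begin

lemma polys_over_0: "0 \<in> polys_over K"
  and polys_over_1: "1 \<in> polys_over K"
  and polys_over_monom: "c \<in> K \<Longrightarrow> monom c n \<in> polys_over K"
  and polys_over_add: "p \<in> polys_over K \<Longrightarrow> q \<in> polys_over K \<Longrightarrow> p + q \<in> polys_over K"
  and polys_over_diff: "p \<in> polys_over K \<Longrightarrow> q \<in> polys_over K \<Longrightarrow> p - q \<in> polys_over K"
  and polys_over_uminus: "p \<in> polys_over K \<Longrightarrow> - p \<in> polys_over K"
  and polys_over_mult: "p \<in> polys_over K \<Longrightarrow> q \<in> polys_over K \<Longrightarrow> p * q \<in> polys_over K"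
  and polys_over_pCons: "pCons a p \<in> polys_over K \<longleftrightarrow> a \<in> K \<and> p \<in> polys_over K"
  using K by (auto simp: polys_over_def subfield_complex_closed subfield_complex_diff coeff_mult
      coeff_pCons intro!: subfield_complex_sum split: nat.splits)

lemmas polys_over_closed = polys_over_0 polys_over_1 polys_over_monom polys_over_add
  polys_over_diff polys_over_uminus polys_over_mult

lemma poly_in_subfield:
  assumes "subfield L complex_field" "K \<subseteq> L" "p \<in> polys_over K" "\<alpha> \<in> L"
  shows "poly p \<alpha> \<in> L"
  using assms(3)
  by (induction p) (use assms in \<open>auto simp: polys_over_pCons subfield_complex_closed\<close>)

text \<open>Long division, with \<open>c\<close> cancelling the leading term; the only division
  performed is that of leading coefficients, so all coefficients stay in \<open>K\<close>.\<close>

lemma polys_over_division: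
  assumes m: "m \<in> polys_over K" "m \<noteq> 0" and "p \<in> polys_over K"
  obtains q r where "q \<in> polys_over K" "r \<in> polys_over K" "p = m * q + r"
    "r = 0 \<or> Polynomial.degree r < Polynomial.degree m"
proof -
  have "\<exists>q\<in>polys_over K. \<exists>r\<in>polys_over K. p = m * q + r \<and>
      (r = 0 \<or> Polynomial.degree r < Polynomial.degree m)"
    using assms(3)
  proof (induction "Polynomial.degree p" arbitrary: p rule: less_induct)
    case less
    show ?case
    proof (cases "p = 0 \<or> Polynomial.degree p < Polynomial.degree m")
      case True
      then show ?thesis using less.prems polys_over_0 by (intro bexI[of _ 0] bexI[of _ p]) auto
    next
      case False
      let ?d = "Polynomial.degree p - Polynomial.degree m"
      define c where "c = monom (Polynomial.lead_coeff p / Polynomial.lead_coeff m) ?d"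
      have c: "c \<in> polys_over K"
        unfolding c_def using K less.prems m(1)
        by (intro polys_over_monom subfield_complex_divide) (auto simp: polys_over_def)
      have deg: "Polynomial.degree (m * c) = Polynomial.degree p"
        using False m(2) by (auto simp: c_def degree_mult_eq degree_monom_eq)
      have lc: "Polynomial.lead_coeff (m * c) = Polynomial.lead_coeff p"
        using m(2) False unfolding lead_coeff_mult by (simp add: c_def degree_monom_eq)
      have p': "p - m * c \<in> polys_over K"
        using less.prems m(1) c by (simp add: polys_over_closed)
      \<comment> \<open>For constant \<open>p\<close> the degree cannot drop below 0, hence the
        separate alternative of a vanishing difference.\<close>
      have "p - m * c = 0 \<or> Polynomial.degree (p - m * c) < Polynomial.degree p"
      proof (rule disjCI)
        assume "\<not> Polynomial.degree (p - m * c) < Polynomial.degree p"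
        then have "Polynomial.degree (p - m * c) = Polynomial.degree p"
          using deg degree_diff_le[of p "Polynomial.degree p" "m * c"] by simp
        then have "Polynomial.lead_coeff (p - m * c) = 0"
          using lc deg by (simp del: leading_coeff_0_iff)
        then show "p - m * c = 0" by (rule leading_coeff_0_iff[THEN iffD1])
      qed
      then obtain q r where "q \<in> polys_over K" "r \<in> polys_over K" "p - m * c = m * q + r"
        "r = 0 \<or> Polynomial.degree r < Polynomial.degree m"
      proof
        assume "p - m * c = 0"
        with that[of 0 0] show thesis by (simp add: polys_over_0)
      next
        assume "Polynomial.degree (p - m * c) < Polynomial.degree p"
        from less.hyps[OF this p'] that show thesis by blast
      qed
      then show ?thesis using c
        by (intro bexI[of _ "q + c"] bexI[of _ r]) (auto simp: algebra_simps polys_over_closed)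
    qed
  qed
  with that show ?thesis by blast
qed

section \<open>Embeddings acting on coefficients\<close>

context
  fixes \<sigma> assumes \<sigma>: "\<sigma> \<in> embeddings K"
begin

lemma coeff_map_poly_embedding: "Polynomial.coeff (map_poly \<sigma> p) i = \<sigma> (Polynomial.coeff p i)"
  by (rule coeff_map_poly) (rule embedding_0[OF K \<sigma>])

lemma map_poly_embedding_add:
  "p \<in> polys_over K \<Longrightarrow> q \<in> polys_over K \<Longrightarrow> map_poly \<sigma> (p + q) = map_poly \<sigma> p + map_poly \<sigma> q"
  by (rule poly_eqI) (simp add: coeff_map_poly_embedding polys_over_def embedding_add[OF K \<sigma>])

lemma map_poly_embedding_diff:
  "p \<in> polys_over K \<Longrightarrow> q \<in> polys_over K \<Longrightarrow> map_poly \<sigma> (p - q) = map_poly \<sigma> p - map_poly \<sigma> q"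
  by (rule poly_eqI) (simp add: coeff_map_poly_embedding polys_over_def embedding_diff[OF K \<sigma>])

lemma map_poly_embedding_mult:
  "p \<in> polys_over K \<Longrightarrow> q \<in> polys_over K \<Longrightarrow> map_poly \<sigma> (p * q) = map_poly \<sigma> p * map_poly \<sigma> q"
  by (rule poly_eqI) (simp add: coeff_map_poly_embedding polys_over_def coeff_mult
      embedding_sum[OF K \<sigma>] subfield_complex_mult[OF K] embedding_mult[OF K \<sigma>])

lemma poly_map_poly_embedding:
  assumes "p \<in> polys_over K" "\<alpha> \<in> K"
  shows "poly (map_poly \<sigma> p) (\<sigma> \<alpha>) = \<sigma> (poly p \<alpha>)"
  using assms(1)
proof (induction p)
  case 0
  then show ?case by (simp add: embedding_0[OF K \<sigma>])
next
  case (pCons a p)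
  moreover from this have "poly p \<alpha> \<in> K" 
    using poly_in_subfield[OF K subset_refl _ assms(2)] by (simp add: polys_over_pCons)
  ultimately show ?case
    using assms(2) K by (simp add: map_poly_pCons embedding_0[OF K \<sigma>] polys_over_pCons
        embedding_add[OF K \<sigma>] embedding_mult[OF K \<sigma>] subfield_complex_mult)
qed

lemma map_poly_embedding_of_rat: "map_poly \<sigma> (map_poly of_rat p) = map_poly of_rat p"
  by (rule poly_eqI) (simp add: coeff_map_poly_embedding coeff_map_poly embedding_of_rat[OF K \<sigma>])

end

section \<open>Simple algebraic extensions\<close>

lemma minimal_polynomial:
  assumes "algebraic_over K \<alpha>"
  obtains m where "m \<in> polys_over K" "m \<noteq> 0" "poly m \<alpha> = 0"
    "\<And>p. p \<in> polys_over K \<Longrightarrow> p \<noteq> 0 \<Longrightarrow> poly p \<alpha> = 0 \<Longrightarrow> Polynomial.degree m \<le> Polynomial.degree p"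
  using assms that
    ex_has_least_nat[of "\<lambda>p. p \<in> polys_over K \<and> p \<noteq> 0 \<and> poly p \<alpha> = 0" _ Polynomial.degree]
  unfolding algebraic_over_def by metis

text \<open>Euclidean descent below the minimal degree: from m = q s + t follows q(\<alpha>)
  s(\<alpha>) = -t(\<alpha>), so inverting t(\<alpha>) inverts q(\<alpha>). If t = 0, then s kills
  \<alpha> and has at least the degree of m, which forces q to be constant.\<close>

lemma poly_inverse_algebraic:
  assumes "algebraic_over K \<alpha>" "p \<in> polys_over K" "poly p \<alpha> \<noteq> 0"
  obtains u where "u \<in> polys_over K" "poly u \<alpha> = inverse (poly p \<alpha>)"
proof -
  obtain m where m: "m \<in> polys_over K" "m \<noteq> 0" "poly m \<alpha> = 0"
    "\<And>p. p \<in> polys_over K \<Longrightarrow> p \<noteq> 0 \<Longrightarrow> poly p \<alpha> = 0 \<Longrightarrow> Polynomial.degree m \<le> Polynomial.degree p"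
    using minimal_polynomial[OF assms(1)] by blast
  have *: "\<exists>u\<in>polys_over K. poly q \<alpha> * poly u \<alpha> = 1"
    if "q \<in> polys_over K" "q \<noteq> 0" "Polynomial.degree q < Polynomial.degree m" for q
    using that
  proof (induction "Polynomial.degree q" arbitrary: q rule: less_induct)
    case less
    obtain s t where st: "s \<in> polys_over K" "t \<in> polys_over K" "m = q * s + t"
      "t = 0 \<or> Polynomial.degree t < Polynomial.degree q"
      using polys_over_division[OF less.prems(1,2) m(1)] by blast
    have q0: "poly q \<alpha> \<noteq> 0" using m(4) less.prems by force
    show ?case
    proof (cases "t = 0")
      case True
      then have "s \<noteq> 0" "poly s \<alpha> = 0" using st m q0 by auto
      then have "Polynomial.degree m \<le> Polynomial.degree s" using m(4) st by blast
      then have "Polynomial.degree q = 0"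
        using True st(3) \<open>s \<noteq> 0\<close> less.prems(2) by (simp add: degree_mult_eq)
      then obtain c where "q = [:c:]" by (auto elim: degree_eq_zeroE)
      then show ?thesis using less.prems K
        by (intro bexI[of _ "[:inverse c:]"]) (auto simp: polys_over_pCons polys_over_0 subfield_complex_inverse)
    next
      case False
      then obtain u where u: "u \<in> polys_over K" "poly t \<alpha> * poly u \<alpha> = 1"
        using less.hyps[of t] st less.prems(3) by auto
      moreover have "poly t \<alpha> = - poly q \<alpha> * poly s \<alpha>"
        using m(3) st(3) by (simp add: eq_neg_iff_add_eq_0 add.commute)
      ultimately show ?thesis using st(1)
        by (intro bexI[of _ "- s * u"]) (auto simp: polys_over_closed mult.assoc)
    qed
  qed
  obtain q r where qr: "q \<in> polys_over K" "r \<in> polys_over K" "p = m * q + r"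
    "r = 0 \<or> Polynomial.degree r < Polynomial.degree m"
    using polys_over_division[OF m(1,2) assms(2)] by blast
  then have pr: "poly p \<alpha> = poly r \<alpha>" using m(3) by simp
  with assms(3) have "r \<noteq> 0" by auto
  then obtain u where "u \<in> polys_over K" "poly r \<alpha> * poly u \<alpha> = 1" using * qr by blast
  with pr that[of u] show ?thesis by (metis inverse_unique)
qed

lemma gen_insert_algebraic:
  assumes "algebraic_over K \<alpha>"
  shows "gen (insert \<alpha> K) = {poly p \<alpha> | p. p \<in> polys_over K}" (is "_ = ?F")
proof
  have "subfield ?F complex_field"
  proof (rule subfield_complexI)
    show "1 \<in> ?F" using polys_over_1 by (intro CollectI exI[of _ 1]) simp
  next
    fix x y assume "x \<in> ?F" "y \<in> ?F"
    then show "x + y \<in> ?F" "x * y \<in> ?F"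
      by (auto, metis poly_add polys_over_add, metis poly_mult polys_over_mult)
  next
    fix x assume "x \<in> ?F"
    then show "- x \<in> ?F" by (auto, metis poly_minus polys_over_uminus)
    assume "x \<noteq> 0"
    with \<open>x \<in> ?F\<close> show "inverse x \<in> ?F"
      by (auto, metis poly_inverse_algebraic[OF assms])
  qed
  moreover have "\<alpha> \<in> ?F"
    using K by (intro CollectI exI[of _ "[:0, 1:]"]) (simp add: polys_over_pCons polys_over_0 subfield_complex_closed)
  moreover have "K \<subseteq> ?F"
  proof
    fix x assume "x \<in> K" then show "x \<in> ?F"
      by (intro CollectI exI[of _ "[:x:]"]) (simp add: polys_over_pCons polys_over_0)
  qed
  ultimately show "gen (insert \<alpha> K) \<subseteq> ?F" by (intro gen_least) auto
  have "\<alpha> \<in> gen (insert \<alpha> K)" "K \<subseteq> gen (insert \<alpha> K)" using gen_superset by blast+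
  then show "?F \<subseteq> gen (insert \<alpha> K)"
    by (auto intro!: poly_in_subfield subfield_gen)
qed

text \<open>Two polynomials representing the same element differ by one that kills \<alpha>, whose
  image kills \<beta>; so substituting \<beta> does not depend on the representative picked by
  \<open>SOME\<close>. Prescribing the target \<beta> is what transitivity on the roots
  needs.\<close>

lemma extend_embedding_to:
  assumes \<sigma>: "\<sigma> \<in> embeddings K" and alg: "algebraic_over K \<alpha>"
    and \<beta>: "\<And>p. p \<in> polys_over K \<Longrightarrow> poly p \<alpha> = 0 \<Longrightarrow> poly (map_poly \<sigma> p) \<beta> = 0"
  obtains \<tau> where "\<tau> \<in> embeddings (gen (insert \<alpha> K))" "\<And>x. x \<in> K \<Longrightarrow> \<tau> x = \<sigma> x" "\<tau> \<alpha> = \<beta>"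
proof -
  define \<tau> where "\<tau> = (\<lambda>x. poly (map_poly \<sigma> (SOME p. p \<in> polys_over K \<and> poly p \<alpha> = x)) \<beta>)"
  have \<tau>: "\<tau> (poly p \<alpha>) = poly (map_poly \<sigma> p) \<beta>" if "p \<in> polys_over K" for p
  proof -
    define q where "q = (SOME q. q \<in> polys_over K \<and> poly q \<alpha> = poly p \<alpha>)"
    have q: "q \<in> polys_over K \<and> poly q \<alpha> = poly p \<alpha>"
      unfolding q_def by (rule someI[of _ p]) (use that in auto)
    then have "poly (map_poly \<sigma> (q - p)) \<beta> = 0"
      using that by (intro \<beta>) (auto simp: polys_over_diff)
    then show ?thesis
      using q that by (simp add: \<tau>_def q_def map_poly_embedding_diff[OF \<sigma>])
  qed
  have K': "\<tau> x = \<sigma> x" if "x \<in> K" for x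
    using \<tau>[of "[:x:]"] that
    by (simp add: polys_over_pCons polys_over_0 map_poly_pCons embedding_0[OF K \<sigma>])
  show ?thesis
  proof (rule that[of \<tau>])
    show "\<tau> \<in> embeddings (gen (insert \<alpha> K))"
      unfolding embeddings_iff gen_insert_algebraic[OF alg]
    proof (intro conjI ballI)
      show "\<tau> 1 = 1" using K' K by (simp add: subfield_complex_1 embedding_1[OF K \<sigma>])
    next
      fix x y assume "x \<in> {poly p \<alpha> |p. p \<in> polys_over K}" "y \<in> {poly p \<alpha> |p. p \<in> polys_over K}"
      then obtain p q where *: "p \<in> polys_over K" "q \<in> polys_over K" and [simp]: "x = poly p \<alpha>" "y = poly q \<alpha>"
        by blast
      show "\<tau> (x + y) = \<tau> x + \<tau> y" "\<tau> (x * y) = \<tau> x * \<tau> y"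
        using * \<tau>[of "p + q"] \<tau>[of "p * q"]
        by (simp_all add: \<tau> polys_over_closed map_poly_embedding_add[OF \<sigma>] map_poly_embedding_mult[OF \<sigma>])
    qed
    show "\<tau> \<alpha> = \<beta>"
      using \<tau>[of "[:0, 1:]"] K
      by (simp add: polys_over_pCons polys_over_0 subfield_complex_closed map_poly_pCons
          embedding_0[OF K \<sigma>] embedding_1[OF K \<sigma>])
  qed (rule K')
qed

text \<open>Any root of the image of the minimal polynomial can serve as \<beta>: it exists by
  algebraic closedness, and every polynomial killing \<alpha> is a multiple of the minimal
  one.\<close>

lemma extend_embedding:
  assumes \<sigma>: "\<sigma> \<in> embeddings K" and alg: "algebraic_over K \<alpha>"
  obtains \<tau> where "\<tau> \<in> embeddings (gen (insert \<alpha> K))" "\<And>x. x \<in> K \<Longrightarrow> \<tau> x = \<sigma> x"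
proof -
  obtain m where m: "m \<in> polys_over K" "m \<noteq> 0" "poly m \<alpha> = 0"
    "\<And>p. p \<in> polys_over K \<Longrightarrow> p \<noteq> 0 \<Longrightarrow> poly p \<alpha> = 0 \<Longrightarrow> Polynomial.degree m \<le> Polynomial.degree p"
    using minimal_polynomial[OF alg] by blast
  have "Polynomial.degree m \<noteq> 0"
  proof
    assume "Polynomial.degree m = 0"
    then obtain c where "m = [:c:]" by (rule degree_eq_zeroE)
    with m(2,3) show False by simp
  qed
  moreover have "Polynomial.degree (map_poly \<sigma> m) = Polynomial.degree m"
    using m(1,2) embedding_eq_0_iff[OF K \<sigma>] by (intro map_poly_degree_eq) (simp add: polys_over_def)
  ultimately obtain \<beta> where \<beta>: "poly (map_poly \<sigma> m) \<beta> = 0"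
    using alg_closed_imp_poly_has_root[of "map_poly \<sigma> m"] by auto
  show ?thesis
  proof (rule extend_embedding_to[OF \<sigma> alg])
    fix p assume p: "p \<in> polys_over K" "poly p \<alpha> = 0"
    obtain q r where qr: "q \<in> polys_over K" "r \<in> polys_over K" "p = m * q + r"
      "r = 0 \<or> Polynomial.degree r < Polynomial.degree m"
      using polys_over_division[OF m(1,2) p(1)] by blast
    with p(2) m(3) have "poly r \<alpha> = 0" by simp
    with m(4) qr have "r = 0" by force
    with qr m(1) \<beta> show "poly (map_poly \<sigma> p) \<beta> = 0" by (simp add: map_poly_embedding_mult[OF \<sigma>])
  qed (use that in auto)
qed

end

lemma extend_embedding_finite:
  assumes "finite S" and K: "subfield K complex_field" and "\<sigma> \<in> embeddings K"
    and "\<And>\<alpha>. \<alpha> \<in> S \<Longrightarrow> algebraic_over K \<alpha>"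
  shows "\<exists>\<tau>\<in>embeddings (gen (K \<union> S)). \<forall>x\<in>K. \<tau> x = \<sigma> x"
  using assms(1,4)
proof (induction S)
  case empty
  have "gen K = K" using gen_least[OF K] gen_superset by blast
  with assms(3) show ?case by auto
next
  case (insert \<alpha> S)
  let ?L = "gen (K \<union> S)"
  obtain \<tau> where \<tau>: "\<tau> \<in> embeddings ?L" "\<And>x. x \<in> K \<Longrightarrow> \<tau> x = \<sigma> x"
    using insert by blast
  have "K \<subseteq> ?L" using gen_superset by blast
  then have "algebraic_over ?L \<alpha>" using insert.prems algebraic_over_mono by blast
  with extend_embedding[OF subfield_gen \<tau>(1)] obtain \<tau>' where
    \<tau>': "\<tau>' \<in> embeddings (gen (insert \<alpha> ?L))" "\<And>x. x \<in> ?L \<Longrightarrow> \<tau>' x = \<tau> x" by blast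
  have "gen (K \<union> insert \<alpha> S) \<subseteq> gen (insert \<alpha> ?L)"
    using gen_superset[of "K \<union> S"] by (intro gen_mono) auto
  with \<tau>'(1) have "\<tau>' \<in> embeddings (gen (K \<union> insert \<alpha> S))" by (rule embeddings_mono)
  moreover have "\<forall>x\<in>K. \<tau>' x = \<sigma> x" using \<tau>'(2) \<tau>(2) \<open>K \<subseteq> ?L\<close> by auto
  ultimately show ?case by blast
qed


section \<open>Roots of rational polynomials\<close>

lemma map_poly_of_rat_add:
  "map_poly of_rat (p + q) = (map_poly of_rat p + map_poly of_rat q :: 'a::field_char_0 poly)"
  by (rule poly_eqI) (simp add: coeff_map_poly of_rat_add)

lemma map_poly_of_rat_mult:
  "map_poly of_rat (p * q) = (map_poly of_rat p * map_poly of_rat q :: 'a::field_char_0 poly)"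
  by (rule poly_eqI) (simp add: coeff_map_poly coeff_mult of_rat_sum of_rat_mult)

text \<open>If \<open>f\<close> and \<open>q\<close> were coprime, Bezout would write 1 as a
  combination that vanishes at z. In this way \<open>f\<close> acts as the minimal polynomial of
  each of its roots.\<close>

lemma irreducible_dvd_if_common_root:
  assumes f: "Factorial_Ring.irreducible f" and z: "z \<in> complex_roots f" "z \<in> complex_roots q"
  shows "f dvd q"
proof (rule ccontr)
  assume "\<not> f dvd q"
  then have "coprime f q"
    using f by (intro prime_elem_imp_coprime irreducible_imp_prime_elem_gcd)
  then obtain s t where "s * f + t * q = 1"
    using bezout_coefficients_fst_snd[of f q] by (auto simp: coprime_iff_gcd_eq_1)
  then have "poly (map_poly of_rat (s * f + t * q)) z = 1" by simp
  then show False
    using z by (simp add: map_poly_of_rat_add map_poly_of_rat_mult complex_roots_def)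
qed

lemma finite_complex_roots: "f \<noteq> 0 \<Longrightarrow> finite (complex_roots f)"
  unfolding complex_roots_def by (intro poly_roots_finite) (simp add: map_poly_eq_0_iff)

text \<open>Separability in characteristic 0: a multiple root would be shared with the derivative,
  which \<open>f\<close> would then divide despite its smaller degree.\<close>

lemma card_complex_roots:
  assumes f: "Factorial_Ring.irreducible f" and "Polynomial.degree f > 0"
  shows "card (complex_roots f) = Polynomial.degree f"
proof -
  let ?F = "map_poly of_rat f :: complex poly"
  have "rsquarefree ?F"
    unfolding rsquarefree_roots
  proof (intro allI notI)
    fix z assume z: "poly ?F z = 0 \<and> poly (pderiv ?F) z = 0"
    have "pderiv ?F = map_poly of_rat (pderiv f)"
      by (rule poly_eqI) (simp add: coeff_pderiv coeff_map_poly of_rat_mult of_rat_add)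
    with z have "z \<in> complex_roots f" "z \<in> complex_roots (pderiv f)"
      by (simp_all add: complex_roots_def)
    then have "f dvd pderiv f" by (rule irreducible_dvd_if_common_root[OF f])
    with assms(2) show False by (simp add: not_dvd_pderiv)
  qed
  then have eq: "Polynomial.smult (Polynomial.lead_coeff ?F) (\<Prod>z|poly ?F z = 0. [:-z, 1:]) = ?F"
    by (rule complex_poly_decompose_rsquarefree)
  have deg: "Polynomial.degree ?F = Polynomial.degree f" by (rule degree_map_poly) simp
  with assms(2) have "Polynomial.lead_coeff ?F \<noteq> 0" unfolding leading_coeff_0_iff by force
  then have "Polynomial.degree ?F = Polynomial.degree (\<Prod>z|poly ?F z = 0. [:-z, 1:])"
    using eq by (metis degree_smult_eq)
  also have "\<dots> = card {z. poly ?F z = 0}" by (subst degree_prod_sum_eq) auto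
  finally show ?thesis using deg by (simp add: complex_roots_def)
qed


section \<open>Galois groups of subfields of the complex numbers\<close>

abbreviation gal :: "complex set \<Rightarrow> (complex \<Rightarrow> complex) monoid" where
  "gal L \<equiv> galois_group complex_field \<rat> L"

lemma Rats_subset_gen: "\<rat> \<subseteq> gen S"
  by (rule Rats_subset_subfield) (rule subfield_gen)

lemma carrier_gal:
  assumes "subfield L complex_field"
  shows "carrier (gal L) = Bij L \<inter> embeddings L"
proof -
  have "\<sigma> x = x" if "\<sigma> \<in> embeddings L" "x \<in> \<rat>" for \<sigma> x
    using Rats_subset_subfield[OF subfield_embedding_fixed[OF assms that(1)]] that(2) by auto
  moreover have "\<sigma> \<in> ring_hom (complex_field\<lparr>carrier := L\<rparr>) (complex_field\<lparr>carrier := L\<rparr>)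
      \<longleftrightarrow> \<sigma> \<in> embeddings L" if "\<sigma> \<in> Bij L" for \<sigma>
    using Bij_imp_funcset[OF that] by (auto simp: ring_hom_def)
  ultimately show ?thesis by (auto simp: galois_group_def)
qed

lemma gal_eq: "subfield L complex_field \<Longrightarrow> gal L = BijGroup L\<lparr>carrier := Bij L \<inter> embeddings L\<rparr>"
  using carrier_gal by (simp add: galois_group_def)

lemma subgroup_gal:
  assumes L: "subfield L complex_field"
  shows "subgroup (Bij L \<inter> embeddings L) (BijGroup L)"
proof (rule group.subgroupI[OF group_BijGroup])
  show "Bij L \<inter> embeddings L \<subseteq> carrier (BijGroup L)" by (auto simp: BijGroup_def)
  have "(\<lambda>x\<in>L. x) \<in> Bij L \<inter> embeddings L"
    using id_Bij[of L] L by (simp add: embeddings_iff subfield_complex_closed)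
  then show "Bij L \<inter> embeddings L \<noteq> {}" by blast
  fix \<sigma> assume \<sigma>: "\<sigma> \<in> Bij L \<inter> embeddings L"
  then have \<sigma>L: "\<sigma> \<in> L \<rightarrow> L" by (simp add: Bij_imp_funcset)
  have inv: "restrict (inv_into L \<sigma>) L \<in> embeddings L"
    unfolding embeddings_iff
  proof (intro conjI ballI)
    have inj: "inj_on \<sigma> L" using \<sigma> by (simp add: Bij_def bij_betw_def)
    have "inv_into L \<sigma> (\<sigma> 1) = 1" using inj subfield_complex_1[OF L] by (rule inv_into_f_f)
    then show "restrict (inv_into L \<sigma>) L 1 = 1"
      using \<sigma> embedding_1[OF L, of \<sigma>] L by (simp add: subfield_complex_1)
    fix x y assume "x \<in> L" "y \<in> L"
    then show "restrict (inv_into L \<sigma>) L (x + y) = restrict (inv_into L \<sigma>) L x + restrict (inv_into L \<sigma>) L y"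
      using \<sigma> L Bij_inv_into_lemma[of L \<sigma> "(+)" x y]
      by (simp add: subfield_complex_closed embeddings_iff Pi_def)
    show "restrict (inv_into L \<sigma>) L (x * y) = restrict (inv_into L \<sigma>) L x * restrict (inv_into L \<sigma>) L y"
      using \<sigma> L Bij_inv_into_lemma[of L \<sigma> "(*)" x y] \<open>x \<in> L\<close> \<open>y \<in> L\<close>
      by (simp add: subfield_complex_closed embeddings_iff Pi_def)
  qed
  then show "inv\<^bsub>BijGroup L\<^esub> \<sigma> \<in> Bij L \<inter> embeddings L"
    using \<sigma> restrict_inv_into_Bij[of \<sigma> L] by (simp add: inv_BijGroup del: restrict_apply)
  fix \<tau> assume \<tau>: "\<tau> \<in> Bij L \<inter> embeddings L"
  then have \<tau>L: "\<tau> \<in> L \<rightarrow> L" by (simp add: Bij_imp_funcset)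
  have "compose L \<sigma> \<tau> \<in> embeddings L"
    using \<sigma> \<tau> \<tau>L L unfolding Int_iff embeddings_iff compose_def
    by (auto simp: subfield_complex_closed Pi_iff)
  then show "\<sigma> \<otimes>\<^bsub>BijGroup L\<^esub> \<tau> \<in> Bij L \<inter> embeddings L"
    using \<sigma> \<tau> by (simp add: BijGroup_def compose_Bij)
qed

lemma group_gal: "subfield L complex_field \<Longrightarrow> group (gal L)"
  using group.subgroup_imp_group[OF group_BijGroup subgroup_gal] by (simp add: gal_eq)

lemma group_action_gal:
  assumes "subfield L complex_field"
  shows "group_action (gal L) L (\<lambda>\<sigma>. \<sigma>)"
proof -
  have "group_action (BijGroup L) L (\<lambda>\<sigma>. \<sigma>)"
    by (intro group_action.intro group_hom.intro group_hom_axioms.intro group_BijGroup)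
      (auto simp: hom_def intro: group.subgroup_self[OF group_BijGroup, THEN subgroup.m_closed])
  from group_action.induced_action[OF this subgroup_gal] show ?thesis
    using assms by (simp add: gal_eq)
qed

lemma mult_gal:
  assumes "subfield L complex_field" "\<sigma> \<in> carrier (gal L)" "\<tau> \<in> carrier (gal L)"
  shows "\<sigma> \<otimes>\<^bsub>gal L\<^esub> \<tau> = compose L \<sigma> \<tau>"
  using assms by (simp add: gal_eq BijGroup_def)

lemma one_gal: "\<one>\<^bsub>gal L\<^esub> = (\<lambda>x\<in>L. x)"
  by (simp add: galois_group_def BijGroup_def)


section \<open>Normal extensions with finitely many generators\<close>

text \<open>The third condition makes every embedding of a subfield \<open>K\<close> extend to \<open>K(S)\<close>; asking for
  this instead of algebraicity avoids having to show that algebraic numbers form a field.\<close>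

definition normal_gens :: "complex set \<Rightarrow> bool" where
  "normal_gens S \<longleftrightarrow> finite S \<and> (\<forall>\<tau>\<in>embeddings (gen S). \<tau> ` S \<subseteq> S) \<and>
     (\<forall>K. subfield K complex_field \<longrightarrow>
       (\<forall>\<sigma>\<in>embeddings K. \<exists>\<tau>\<in>embeddings (gen (K \<union> S)). \<forall>x\<in>K. \<tau> x = \<sigma> x))"

lemma normal_gens_finite: "normal_gens S \<Longrightarrow> finite S"
  and normal_gens_stable: "normal_gens S \<Longrightarrow> \<tau> \<in> embeddings (gen S) \<Longrightarrow> \<tau> ` S \<subseteq> S"
  and normal_gens_extend: "normal_gens S \<Longrightarrow> subfield K complex_field \<Longrightarrow> \<sigma> \<in> embeddings K \<Longrightarrow>
    \<exists>\<tau>\<in>embeddings (gen (K \<union> S)). \<forall>x\<in>K. \<tau> x = \<sigma> x"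
  unfolding normal_gens_def by blast+

lemma normal_gens_image:
  assumes "normal_gens S" "\<tau> \<in> embeddings (gen S)"
  shows "\<tau> ` S = S"
proof (rule endo_inj_surj[OF normal_gens_finite[OF assms(1)] normal_gens_stable[OF assms]])
  show "inj_on \<tau> S"
    using inj_on_embedding[OF subfield_gen assms(2)] gen_superset by (rule inj_on_subset)
qed

lemma normal_gens_image_gen:
  assumes "normal_gens S" "\<tau> \<in> embeddings (gen S)"
  shows "\<tau> ` gen S = gen S"
  using embedding_image_gen[OF subfield_gen assms(2) gen_superset] normal_gens_image[OF assms] by simp

text \<open>The essence of normality: an embedding into the complex numbers is already an
  automorphism. Restricting only makes it extensional.\<close>

lemma restrict_embedding_in_gal:
  assumes "normal_gens S" "\<tau> \<in> embeddings (gen S)"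
  shows "restrict \<tau> (gen S) \<in> carrier (gal (gen S))"
proof -
  have "bij_betw \<tau> (gen S) (gen S)"
    using inj_on_embedding[OF subfield_gen assms(2)] normal_gens_image_gen[OF assms]
    by (simp add: bij_betw_def)
  then have "restrict \<tau> (gen S) \<in> Bij (gen S)" by (simp add: Bij_def)
  moreover have "restrict \<tau> (gen S) \<in> embeddings (gen S)"
    using assms(2) subfield_gen[of S] by (simp add: embeddings_iff subfield_complex_closed)
  ultimately show ?thesis by (simp add: carrier_gal subfield_gen)
qed

lemma gal_embedding: "\<sigma> \<in> carrier (gal (gen S)) \<Longrightarrow> \<sigma> \<in> embeddings (gen S)"
  by (simp add: carrier_gal subfield_gen)

lemma gal_extensional: "\<sigma> \<in> carrier (gal (gen S)) \<Longrightarrow> \<sigma> \<in> extensional (gen S)"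
  by (simp add: carrier_gal subfield_gen Bij_imp_extensional)

lemma gal_closed: "\<sigma> \<in> carrier (gal (gen S)) \<Longrightarrow> x \<in> gen S \<Longrightarrow> \<sigma> x \<in> gen S"
  using Bij_imp_funcset[of \<sigma> "gen S"] by (auto simp: carrier_gal subfield_gen)

lemma gal_eqI:
  assumes "\<sigma> \<in> carrier (gal (gen S))" "\<tau> \<in> carrier (gal (gen S))" "\<And>x. x \<in> S \<Longrightarrow> \<sigma> x = \<tau> x"
  shows "\<sigma> = \<tau>"
  using gal_extensional[OF assms(1)] gal_extensional[OF assms(2)]
    embedding_eq_on_gen[OF gal_embedding[OF assms(1)] gal_embedding[OF assms(2)] assms(3)]
  by (rule extensionalityI)

lemma gal_extend:
  assumes "normal_gens S" "subfield K complex_field" "K \<subseteq> gen S" "\<sigma> \<in> embeddings K"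
  obtains \<tau> where "\<tau> \<in> carrier (gal (gen S))" "\<And>x. x \<in> K \<Longrightarrow> \<tau> x = \<sigma> x"
proof -
  obtain \<tau> where \<tau>: "\<tau> \<in> embeddings (gen (K \<union> S))" "\<forall>x\<in>K. \<tau> x = \<sigma> x"
    using normal_gens_extend[OF assms(1,2,4)] by blast
  have "\<tau> \<in> embeddings (gen S)"
    using \<tau>(1) by (rule embeddings_mono) (simp add: gen_mono)
  then have "restrict \<tau> (gen S) \<in> carrier (gal (gen S))" by (rule restrict_embedding_in_gal[OF assms(1)])
  then show ?thesis using \<tau>(2) assms(3) by (intro that[of "restrict \<tau> (gen S)"]) auto
qed

text \<open>Restriction is well defined because the smaller field is normal, and onto because the
  larger one is.\<close>

lemma gal_restriction_hom:
  assumes S: "normal_gens S" and T: "normal_gens T" and "S \<subseteq> T"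
  shows "group_hom (gal (gen T)) (gal (gen S)) (\<lambda>\<sigma>. restrict \<sigma> (gen S))"
    and "(\<lambda>\<sigma>. restrict \<sigma> (gen S)) ` carrier (gal (gen T)) = carrier (gal (gen S))"
proof -
  have sub: "gen S \<subseteq> gen T" using \<open>S \<subseteq> T\<close> by (rule gen_mono)
  have res: "restrict \<sigma> (gen S) \<in> carrier (gal (gen S))" if "\<sigma> \<in> carrier (gal (gen T))" for \<sigma>
    using restrict_embedding_in_gal[OF S] embeddings_mono[OF gal_embedding[OF that] sub] .
  show "group_hom (gal (gen T)) (gal (gen S)) (\<lambda>\<sigma>. restrict \<sigma> (gen S))"
  proof (intro group_hom.intro group_hom_axioms.intro homI group_gal subfield_gen)
    fix \<sigma> \<tau> assume \<sigma>\<tau>: "\<sigma> \<in> carrier (gal (gen T))" "\<tau> \<in> carrier (gal (gen T))"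
    then show "restrict (\<sigma> \<otimes>\<^bsub>gal (gen T)\<^esub> \<tau>) (gen S) =
        restrict \<sigma> (gen S) \<otimes>\<^bsub>gal (gen S)\<^esub> restrict \<tau> (gen S)"
      using res gal_closed[OF res[OF \<sigma>\<tau>(2)]] sub
      by (auto simp: mult_gal subfield_gen compose_def fun_eq_iff)
  qed (rule res)
  show "(\<lambda>\<sigma>. restrict \<sigma> (gen S)) ` carrier (gal (gen T)) = carrier (gal (gen S))"
  proof (intro equalityI image_subsetI res subsetI)
    fix \<sigma> assume \<sigma>: "\<sigma> \<in> carrier (gal (gen S))"
    obtain \<tau> where \<tau>: "\<tau> \<in> carrier (gal (gen T))" "\<And>x. x \<in> gen S \<Longrightarrow> \<tau> x = \<sigma> x"
      using gal_extend[OF T subfield_gen sub gal_embedding[OF \<sigma>]] by blast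
    have "restrict \<tau> (gen S) = \<sigma>"
      using \<tau>(2) gal_extensional[OF \<sigma>] by (intro extensionalityI[of _ "gen S"]) auto
    then show "\<sigma> \<in> (\<lambda>\<sigma>. restrict \<sigma> (gen S)) ` carrier (gal (gen T))" using \<tau>(1) by blast
  qed
qed

section \<open>Sources of normal extensions\<close>

lemma algebraic_over_complex_root:
  assumes "subfield K complex_field" "f \<noteq> 0" "z \<in> complex_roots f"
  shows "algebraic_over K z"
  using assms map_poly_of_rat_polys_over[OF assms(1), of f]
  by (auto simp: algebraic_over_def complex_roots_def map_poly_eq_0_iff
      intro!: bexI[of _ "map_poly of_rat f"])

lemma normal_gens_complex_roots:
  assumes "f \<noteq> 0"
  shows "normal_gens (complex_roots f)"
  unfolding normal_gens_def
proof (intro conjI ballI allI impI image_subsetI)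
  show "finite (complex_roots f)" using assms by (rule finite_complex_roots)
next
  fix \<tau> z assume \<tau>: "\<tau> \<in> embeddings (gen (complex_roots f))" and z: "z \<in> complex_roots f"
  have "poly (map_poly \<tau> (map_poly of_rat f)) (\<tau> z) = \<tau> (poly (map_poly of_rat f) z)"
    by (rule poly_map_poly_embedding[OF subfield_gen \<tau>])
      (use z gen_superset in \<open>auto intro: map_poly_of_rat_polys_over subfield_gen\<close>)
  then show "\<tau> z \<in> complex_roots f"
    using z by (simp add: complex_roots_def map_poly_embedding_of_rat[OF subfield_gen \<tau>]
        embedding_0[OF subfield_gen \<tau>])
next
  fix K \<sigma> assume "subfield K complex_field" "\<sigma> \<in> embeddings K"
  then show "\<exists>\<tau>\<in>embeddings (gen (K \<union> complex_roots f)). \<forall>x\<in>K. \<tau> x = \<sigma> x"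
    using assms by (intro extend_embedding_finite) (auto intro: finite_complex_roots algebraic_over_complex_root)
qed

text \<open>Used to bound the conjugates of an element: its image under an embedding depends only on
  the restriction to a finite generating set.\<close>

lemma finite_image_if_factors:
  assumes "finite (f ` A)" "\<And>x y. x \<in> A \<Longrightarrow> y \<in> A \<Longrightarrow> f x = f y \<Longrightarrow> g x = g y"
  shows "finite (g ` A)"
proof -
  have "g x = g (inv_into A f (f x))" if "x \<in> A" for x
    using that assms(2)[OF that inv_into_into[of "f x" f A]] by (simp add: f_inv_into_f)
  then have "g ` A \<subseteq> (\<lambda>v. g (inv_into A f v)) ` f ` A" by blast
  then show ?thesis using assms(1) by (meson finite_imageI finite_subset)
qed

text \<open>Adjoining only the \<open>n\<close>-th roots of \<open>c\<close> itself would in general destroy normality.\<close>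

definition adjoin_roots :: "nat \<Rightarrow> complex \<Rightarrow> complex set \<Rightarrow> complex set" where
  "adjoin_roots n c S = S \<union> {z. \<exists>\<tau>\<in>embeddings (gen S). z ^ n = \<tau> c}"

lemma adjoin_roots_superset: "S \<subseteq> adjoin_roots n c S"
  by (simp add: adjoin_roots_def)

text \<open>The identity embedding makes \<open>c\<close> one of its own conjugates.\<close>

lemma adjoin_rootsI: "z ^ n = c \<Longrightarrow> z \<in> adjoin_roots n c S"
  by (auto simp: adjoin_roots_def embeddings_iff intro!: bexI[of _ "\<lambda>x. x"])

lemma normal_gens_adjoin_roots:
  assumes S: "normal_gens S" and c: "c \<in> gen S" and n: "n > 0"
  shows "normal_gens (adjoin_roots n c S)"
proof -
  let ?E = "embeddings (gen S)" and ?T = "adjoin_roots n c S"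
  have sub: "gen S \<subseteq> gen ?T" by (rule gen_mono) (rule adjoin_roots_superset)
  have conj: "\<tau> c \<in> gen S" if "\<tau> \<in> ?E" for \<tau>
    using normal_gens_image_gen[OF S that] c by blast
  have "finite ((\<lambda>\<tau>. \<tau> c) ` ?E)"
  proof (rule finite_image_if_factors)
    have "(\<lambda>\<tau>. restrict \<tau> S) ` ?E \<subseteq> S \<rightarrow>\<^sub>E S"
      using normal_gens_stable[OF S] by fastforce
    then show "finite ((\<lambda>\<tau>. restrict \<tau> S) ` ?E)"
      using normal_gens_finite[OF S] by (meson finite_PiE finite_subset)
    fix \<sigma> \<tau> assume \<sigma>\<tau>: "\<sigma> \<in> ?E" "\<tau> \<in> ?E" "restrict \<sigma> S = restrict \<tau> S"
    then have "\<And>x. x \<in> S \<Longrightarrow> \<sigma> x = \<tau> x" by (metis restrict_apply')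
    then show "\<sigma> c = \<tau> c" using embedding_eq_on_gen \<sigma>\<tau>(1,2) c by blast
  qed
  then have "finite (\<Union>d\<in>(\<lambda>\<tau>. \<tau> c) ` ?E. {z. z ^ n = d})"
    using n by (intro finite_UN_I) auto
  also have "(\<Union>d\<in>(\<lambda>\<tau>. \<tau> c) ` ?E. {z. z ^ n = d}) = {z. \<exists>\<tau>\<in>?E. z ^ n = \<tau> c}" by auto
  finally have fin: "finite ?T" using normal_gens_finite[OF S] by (simp add: adjoin_roots_def)
  have stable: "\<tau> z \<in> ?T" if \<tau>: "\<tau> \<in> embeddings (gen ?T)" and z: "z \<in> ?T" for \<tau> z
  proof -
    have \<tau>S: "\<tau> \<in> ?E" using \<tau> sub by (rule embeddings_mono)
    show ?thesis
    proof (cases "z \<in> S")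
      case True
      then show ?thesis using normal_gens_stable[OF S \<tau>S] adjoin_roots_superset by blast
    next
      case False
      then obtain \<rho> where \<rho>: "\<rho> \<in> ?E" "z ^ n = \<rho> c" using z by (auto simp: adjoin_roots_def)
      \<comment> \<open>Since \<rho> preserves \<open>gen S\<close>, composing it with \<tau> gives
        an embedding again; hence \<tau> z is an n-th root of another conjugate of
        \<open>c\<close>.\<close>
      have "\<rho> x \<in> gen S" if "x \<in> gen S" for x
        using normal_gens_image_gen[OF S \<rho>(1)] that by blast
      then have "(\<lambda>x. \<tau> (\<rho> x)) \<in> ?E" using \<rho>(1) \<tau>S by (simp add: embeddings_iff)
      moreover have "\<tau> z ^ n = \<tau> (\<rho> c)"
        using embedding_power[OF subfield_gen \<tau> generate_field.incl[OF z], of n] \<rho>(2) by simp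
      ultimately show ?thesis
        unfolding adjoin_roots_def by (intro UnI2 CollectI bexI[of _ "\<lambda>x. \<tau> (\<rho> x)"])
    qed
  qed
  have extend: "\<exists>\<tau>\<in>embeddings (gen (K \<union> ?T)). \<forall>x\<in>K. \<tau> x = \<sigma> x"
    if K: "subfield K complex_field" and \<sigma>: "\<sigma> \<in> embeddings K" for K \<sigma>
  proof -
    \<comment> \<open>Algebraicity is tested over \<open>?M\<close> because the conjugates of
      \<open>c\<close> lie there, and not necessarily in \<open>K\<close>.\<close>
    let ?M = "gen (K \<union> S)"
    note M = subfield_gen[of "K \<union> S"]
    obtain \<tau> where \<tau>: "\<tau> \<in> embeddings ?M" "\<forall>x\<in>K. \<tau> x = \<sigma> x"
      using normal_gens_extend[OF S K \<sigma>] by blast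
    have "algebraic_over ?M z" if z: "z \<in> ?T" for z
    proof -
      have "\<exists>m>0. z ^ m \<in> ?M"
      proof (cases "z \<in> S")
        case True
        then show ?thesis by (intro exI[of _ 1]) (simp add: generate_field.incl)
      next
        case False
        then obtain \<rho> where \<rho>: "\<rho> \<in> ?E" "z ^ n = \<rho> c" using z by (auto simp: adjoin_roots_def)
        then show ?thesis using conj n gen_mono[of S "K \<union> S"] by (intro exI[of _ n]) auto
      qed
      then obtain m where m: "m > 0" "z ^ m \<in> ?M" by blast
      let ?p = "monom 1 m - [:z ^ m:]"
      have "?p \<in> polys_over ?M"
        using m(2) M by (intro polys_over_closed) (auto simp: polys_over_pCons polys_over_0 subfield_complex_closed)
      moreover have "?p \<noteq> 0"
      proof
        assume "?p = 0"
        then have "Polynomial.coeff ?p m = 0" by simp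
        with m(1) show False by (simp add: coeff_pCons split: nat.splits)
      qed
      moreover have "poly ?p z = 0" by (simp add: poly_monom)
      ultimately show ?thesis unfolding algebraic_over_def by blast
    qed
    then obtain \<tau>' where \<tau>': "\<tau>' \<in> embeddings (gen (?M \<union> ?T))" "\<forall>x\<in>?M. \<tau>' x = \<tau> x"
      using extend_embedding_finite[OF fin M \<tau>(1)] by blast
    have "K \<subseteq> ?M" using gen_superset by blast
    then have "gen (K \<union> ?T) \<subseteq> gen (?M \<union> ?T)" by (intro gen_mono) auto
    with \<tau>'(1) have "\<tau>' \<in> embeddings (gen (K \<union> ?T))" by (rule embeddings_mono)
    moreover have "\<forall>x\<in>K. \<tau>' x = \<sigma> x" using \<tau>'(2) \<tau>(2) \<open>K \<subseteq> ?M\<close> by auto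
    ultimately show ?thesis by blast
  qed
  show ?thesis unfolding normal_gens_def using fin stable extend by blast
qed


section \<open>Radical towers\<close>

text \<open>The n-th roots of unity are powers of one of them, \<omega>; automorphisms raise
  \<omega> to powers, and exponents multiply commutatively.\<close>

lemma derived_gal_fixes_roots_of_unity:
  assumes roots: "\<And>z. z ^ n = 1 \<Longrightarrow> z \<in> gen S" and n: "n > 0"
    and "\<sigma> \<in> derived (gal (gen S)) (carrier (gal (gen S)))" "z ^ n = 1"
  shows "\<sigma> z = z"
proof (rule group_action.derived_fixes[OF group_action_gal[OF subfield_gen]])
  show "subgroup (carrier (gal (gen S))) (gal (gen S))"
    by (rule group.subgroup_self[OF group_gal[OF subfield_gen]])
  show "{z. z ^ n = 1} \<subseteq> gen S" using roots by blast
  have power: "\<sigma> (x ^ i) = \<sigma> x ^ i" if "\<sigma> \<in> carrier (gal (gen S))" "x \<in> gen S" for \<sigma> x i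
    using embedding_power[OF subfield_gen gal_embedding[OF that(1)] that(2)] .
  show stable: "\<sigma> z \<in> {z. z ^ n = 1}" if "\<sigma> \<in> carrier (gal (gen S))" "z \<in> {z. z ^ n = 1}" for \<sigma> z
    using power[OF that(1) roots, of z n] that embedding_1[OF subfield_gen gal_embedding[OF that(1)]] by simp
  define \<omega> where "\<omega> = cis (2 * pi / real n)"
  have \<omega>: "\<omega> ^ n = 1" using n by (simp add: \<omega>_def DeMoivre)
  have generates: "\<exists>k. z = \<omega> ^ k" if "z ^ n = 1" for z
  proof -
    have "z \<in> (\<lambda>k. cis (2 * pi * real k / real n)) ` {..<n}"
      unfolding bij_betw_imp_surj_on[OF bij_betw_roots_unity[OF n]] using that by simp
    then obtain k where "z = cis (2 * pi * real k / real n)" by (rule imageE)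
    then have "z = \<omega> ^ k" by (simp add: \<omega>_def DeMoivre mult.commute)
    then show ?thesis ..
  qed
  show "\<sigma> (\<tau> z) = \<tau> (\<sigma> z)"
    if \<sigma>: "\<sigma> \<in> carrier (gal (gen S))" and \<tau>: "\<tau> \<in> carrier (gal (gen S))" and z: "z \<in> {z. z ^ n = 1}" for \<sigma> \<tau> z
  proof -
    have "\<sigma> \<omega> ^ n = 1" "\<tau> \<omega> ^ n = 1" "z ^ n = 1"
      using stable[OF \<sigma>, of \<omega>] stable[OF \<tau>, of \<omega>] \<omega> z by simp_all
    then obtain i j k where *: "\<sigma> \<omega> = \<omega> ^ i" "\<tau> \<omega> = \<omega> ^ j" "z = \<omega> ^ k"
      using generates by metis
    show ?thesis
      using * power[OF \<sigma> roots[OF \<omega>]] power[OF \<tau> roots[OF \<omega>]] by (simp flip: power_mult add: mult_ac)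
  qed
qed (use assms in auto)

text \<open>No normal closure of the tower itself is needed: it suffices to follow the derived series of
  the automorphism group of one sufficiently large normal field.\<close>

definition derived_fixes_above :: "complex set \<Rightarrow> nat \<Rightarrow> complex set \<Rightarrow> bool" where
  "derived_fixes_above S k L \<longleftrightarrow> (\<forall>T \<sigma> x. normal_gens T \<longrightarrow> S \<subseteq> T \<longrightarrow>
     \<sigma> \<in> (derived (gal (gen T)) ^^ k) (carrier (gal (gen T))) \<longrightarrow> x \<in> L \<longrightarrow> \<sigma> x = x)"

lemma derived_fixes_aboveD:
  "\<sigma> x = x" if "derived_fixes_above S k L" "normal_gens T" "S \<subseteq> T"
    "\<sigma> \<in> (derived (gal (gen T)) ^^ k) (carrier (gal (gen T)))" "x \<in> L"
  using that(1)[unfolded derived_fixes_above_def, rule_format, OF that(2-5)] .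

text \<open>Each radical step costs one derived subgroup and an enlargement of \<open>S\<close>.
  Keeping the initial generators in \<open>S\<close> allows restricting to the splitting field
  afterwards.\<close>

lemma radical_extension_fixed:
  assumes "radical_extension complex_field \<rat> L" and S\<^sub>0: "normal_gens S\<^sub>0"
  shows "\<exists>S k. normal_gens S \<and> S\<^sub>0 \<subseteq> S \<and> L \<subseteq> gen S \<and> derived_fixes_above S (Suc k) L"
  using assms(1)
proof (induction rule: radical_extension.induct)
  case base
  \<comment> \<open>Index 0 would already fix the rationals; starting at 1 places all later terms
    inside the first derived subgroup, which fixes the roots of unity.\<close>
  have fixed: "\<sigma> x = x" if "\<sigma> \<in> (derived (gal (gen T)) ^^ Suc 0) (carrier (gal (gen T)))" "x \<in> \<rat>" for T \<sigma> x
  proof -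
    have "\<sigma> \<in> carrier (gal (gen T))"
      using group.exp_of_derived_in_carrier[OF group_gal[OF subfield_gen] subset_refl] that(1) by blast
    then show ?thesis
      using Rats_subset_subfield[OF subfield_embedding_fixed[OF subfield_gen gal_embedding]] that(2) by blast
  qed
  then have "derived_fixes_above S\<^sub>0 (Suc 0) \<rat>"
    unfolding derived_fixes_above_def by (intro allI impI) (rule fixed)
  then show ?case using S\<^sub>0 Rats_subset_gen by blast
next
  case (adjoin L \<alpha> n)
  then obtain S k where S: "normal_gens S" "S\<^sub>0 \<subseteq> S" "L \<subseteq> gen S"
    and fixed: "derived_fixes_above S (Suc k) L"
    by blast
  define c where "c = \<alpha> ^ n"
  have n: "n > 0" and c: "c \<in> L" using adjoin.hyps by (simp_all add: c_def)
  \<comment> \<open>First the n-th roots of unity are adjoined, then the n-th roots of all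
    conjugates of \<open>c\<close>; \<alpha> is among the latter.\<close>
  define S1 where "S1 = adjoin_roots n 1 S"
  define S2 where "S2 = adjoin_roots n c S1"
  have S1: "normal_gens S1"
    unfolding S1_def by (intro normal_gens_adjoin_roots S n subfield_complex_1 subfield_gen)
  have sub: "S \<subseteq> S1" "S1 \<subseteq> S2" by (simp_all add: S1_def S2_def adjoin_roots_superset)
  then have "c \<in> gen S1" using c S(3) gen_mono by blast
  then have S2: "normal_gens S2" unfolding S2_def by (rule normal_gens_adjoin_roots[OF S1 _ n])
  have \<alpha>: "\<alpha> \<in> gen S2" by (rule generate_field.incl) (simp add: S2_def c_def adjoin_rootsI)
  have fixed': "\<sigma> x = x"
    if T: "normal_gens T" "S2 \<subseteq> T" and \<sigma>: "\<sigma> \<in> (derived (gal (gen T)) ^^ Suc (Suc k)) (carrier (gal (gen T)))"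
      and x: "x \<in> gen (insert \<alpha> L)" for T \<sigma> x
  proof -
    let ?G = "gal (gen T)"
    define H where "H = (derived ?G ^^ Suc k) (carrier ?G)"
    interpret G: group ?G by (rule group_gal[OF subfield_gen])
    interpret act: group_action ?G "gen T" "\<lambda>\<sigma>. \<sigma>" by (rule group_action_gal[OF subfield_gen])
    have H: "subgroup H ?G"
      unfolding H_def by (rule G.exp_of_derived_is_subgroup[OF G.subgroup_self])
    have HD: "H \<subseteq> derived ?G (carrier ?G)"
      unfolding H_def funpow.simps comp_apply
      by (intro G.mono_derived G.exp_of_derived_in_carrier subset_refl)
    have HG: "H \<subseteq> carrier ?G" using H by (rule subgroup.subset)
    have emb: "h \<in> embeddings (gen T)" if "h \<in> H" for h
      using that HG gal_embedding by blast
    have roots1: "z \<in> gen T" if "z ^ n = 1" for z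
      using adjoin_rootsI[OF that, of S] sub T by (intro generate_field.incl) (auto simp: S1_def)
    have rootsc: "z \<in> gen T" if "z ^ n = c" for z
      using adjoin_rootsI[OF that, of S1] T by (intro generate_field.incl) (auto simp: S2_def)
    have unity: "h z = z" if "h \<in> H" "z ^ n = 1" for h z
      using derived_gal_fixes_roots_of_unity[OF roots1 n _ that(2)] HD that(1) by blast
    have HL: "h y = y" if "h \<in> H" "y \<in> L" for h y
    proof (rule derived_fixes_aboveD[OF fixed T(1)])
      show "S \<subseteq> T" using sub T(2) by blast
      show "h \<in> (derived ?G ^^ Suc k) (carrier ?G)" using that(1) unfolding H_def .
    qed (rule that(2))
    have stable: "h z ^ n = c" if "h \<in> H" "z ^ n = c" for h z
      using embedding_power[OF subfield_gen emb[OF that(1)] rootsc[OF that(2)], of n] that(2) HL[OF that(1) c] by simp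
    have comm: "g (h z) = h (g z)" if gh: "g \<in> H" "h \<in> H" and z: "z ^ n = c" for g h z
    proof (cases "z = 0")
      case True
      then show ?thesis using gh[THEN emb, THEN embedding_0[OF subfield_gen]] by simp
    next
      case False
      have unit: "(a z / z) ^ n = 1" if "a \<in> H" for a
        using stable[OF that z] z False by (metis divide_self power_divide power_not_zero)
      \<comment> \<open>The quotient b z / z is an n-th root of unity, hence fixed by a. The
        resulting product is symmetric in a and b.\<close>
      have twist: "a (b z) = (b z / z) * a z" if "a \<in> H" "b \<in> H" for a b
      proof -
        have "a (b z) = a ((b z / z) * z)" using False by simp
        also have "\<dots> = a (b z / z) * a z"
          by (intro embedding_mult[OF subfield_gen emb[OF that(1)]] roots1 unit rootsc z that)
        finally show ?thesis using unity[OF that(1) unit[OF that(2)]] by simp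
      qed
      show ?thesis using twist[OF gh] twist[OF gh(2,1)] by simp
    qed
    have \<sigma>H: "\<sigma> \<in> derived ?G H" using \<sigma> by (simp add: H_def)
    \<comment> \<open>The argument runs over all n-th roots of \<open>c\<close>, since \<alpha>
      alone need not be stable under \<open>H\<close>.\<close>
    have "\<sigma> \<alpha> = \<alpha>"
      by (rule act.derived_fixes[OF H _ _ _ \<sigma>H, of "{z. z ^ n = c}"])
        (use rootsc stable comm in \<open>auto simp: c_def\<close>)
    moreover have "\<sigma> \<in> H" using G.derived_incl[OF subset_refl H] \<sigma>H by blast
    moreover have "\<alpha> \<in> gen T" using \<alpha> gen_mono[OF T(2)] by blast
    moreover have "L \<subseteq> gen T" using S(3) gen_mono[of S T] sub T(2) by blast
    ultimately have "insert \<alpha> L \<subseteq> {x \<in> gen T. \<sigma> x = x}" using HL by blast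
    then have "gen (insert \<alpha> L) \<subseteq> {x \<in> gen T. \<sigma> x = x}"
      by (intro gen_least subfield_embedding_fixed subfield_gen emb \<open>\<sigma> \<in> H\<close>)
    with x show ?thesis by blast
  qed
  have L': "gen (insert \<alpha> L) \<subseteq> gen S2"
    using \<alpha> S(3) gen_mono[of S S2] sub by (intro gen_subset_gen) blast
  have "S\<^sub>0 \<subseteq> S2" using S(2) sub by blast
  moreover have "derived_fixes_above S2 (Suc (Suc k)) (gen (insert \<alpha> L))"
    unfolding derived_fixes_above_def by (intro allI impI) (rule fixed')
  ultimately show ?case using S2 L' by blast
qed

lemma splitting_field_eq_gen: "splitting_field f = gen (complex_roots f)"
  unfolding splitting_field_def
proof
  show "gen (\<rat> \<union> complex_roots f) \<subseteq> gen (complex_roots f)"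
    using Rats_subset_gen gen_superset by (intro gen_subset_gen) auto
qed (rule gen_mono, simp)

text \<open>Restriction to the splitting field carries the derived series of the large normal field
  onto its own, and the term fixing the radical extension becomes trivial there.\<close>

lemma solvable_by_radicals_derived_series:
  assumes "f \<noteq> 0" "solvable_by_radicals f"
  obtains n where "(derived (gal (splitting_field f)) ^^ n) (carrier (gal (splitting_field f))) =
    {\<one>\<^bsub>gal (splitting_field f)\<^esub>}"
proof -
  let ?R = "complex_roots f"
  note R = normal_gens_complex_roots[OF assms(1)]
  obtain L where L: "radical_extension complex_field \<rat> L" "splitting_field f \<subseteq> L"
    using assms(2) by (auto simp: solvable_by_radicals_def)
  obtain S k where S: "normal_gens S" "?R \<subseteq> S" and fixed: "derived_fixes_above S (Suc k) L"
    using radical_extension_fixed[OF L(1) R] by blast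
  let ?\<rho> = "\<lambda>\<sigma>. restrict \<sigma> (gen ?R)"
  let ?D = "(derived (gal (gen S)) ^^ Suc k) (carrier (gal (gen S)))"
  interpret G: group "gal (gen S)" by (rule group_gal[OF subfield_gen])
  have "?\<rho> \<sigma> = \<one>\<^bsub>gal (gen ?R)\<^esub>" if "\<sigma> \<in> ?D" for \<sigma>
    unfolding one_gal
  proof (rule restrict_ext)
    show "\<sigma> x = x" if "x \<in> gen ?R" for x
      using derived_fixes_aboveD[OF fixed S(1) subset_refl \<open>\<sigma> \<in> ?D\<close>] that L(2)
      unfolding splitting_field_eq_gen by blast
  qed
  moreover have "?D \<noteq> {}"
    using subgroup.one_closed[OF G.exp_of_derived_is_subgroup[OF G.subgroup_self]] by blast
  ultimately have "?\<rho> ` ?D = {\<one>\<^bsub>gal (gen ?R)\<^esub>}" by (auto simp: image_iff)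
  then have "(derived (gal (gen ?R)) ^^ Suc k) (carrier (gal (gen ?R))) = {\<one>\<^bsub>gal (gen ?R)\<^esub>}"
    using group_hom.exp_of_derived_img[OF gal_restriction_hom(1)[OF R S] subset_refl, of "Suc k"]
    unfolding gal_restriction_hom(2)[OF R S] by simp
  with that show ?thesis unfolding splitting_field_eq_gen by blast
qed


section \<open>The action of the Galois group on the roots\<close>

lemma gal_faithful_action:
  assumes S: "normal_gens S"
  shows "faithful_action (gal (gen S)) S (\<lambda>\<sigma>. restrict \<sigma> S)"
proof (intro faithful_action.intro faithful_action_axioms.intro group_action.intro group_hom.intro
    group_hom_axioms.intro group_gal subfield_gen group_BijGroup homI)
  have Bij: "restrict \<sigma> S \<in> Bij S" if "\<sigma> \<in> carrier (gal (gen S))" for \<sigma>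
    using normal_gens_image[OF S gal_embedding[OF that]]
      inj_on_subset[OF inj_on_embedding[OF subfield_gen gal_embedding[OF that]] gen_superset]
    by (simp add: Bij_def bij_betw_def)
  then show "restrict \<sigma> S \<in> carrier (BijGroup S)" if "\<sigma> \<in> carrier (gal (gen S))" for \<sigma>
    using that by (simp add: BijGroup_def)
  fix \<sigma> \<tau> assume \<sigma>\<tau>: "\<sigma> \<in> carrier (gal (gen S))" "\<tau> \<in> carrier (gal (gen S))"
  have "\<tau> x \<in> S" if "x \<in> S" for x
    using normal_gens_image[OF S gal_embedding[OF \<sigma>\<tau>(2)]] that by blast
  then show "restrict (\<sigma> \<otimes>\<^bsub>gal (gen S)\<^esub> \<tau>) S = restrict \<sigma> S \<otimes>\<^bsub>BijGroup S\<^esub> restrict \<tau> S"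
    using \<sigma>\<tau> Bij generate_field.incl[of _ S]
    by (auto simp: mult_gal subfield_gen BijGroup_def compose_def fun_eq_iff)
next
  show "inj_on (\<lambda>\<sigma>. restrict \<sigma> S) (carrier (gal (gen S)))"
  proof (rule inj_onI)
    fix \<sigma> \<tau> assume \<sigma>\<tau>: "\<sigma> \<in> carrier (gal (gen S))" "\<tau> \<in> carrier (gal (gen S))"
      and eq: "restrict \<sigma> S = restrict \<tau> S"
    have "\<sigma> x = \<tau> x" if "x \<in> S" for x using fun_cong[OF eq, of x] that by simp
    then show "\<sigma> = \<tau>" by (rule gal_eqI[OF \<sigma>\<tau>])
  qed
qed

lemma subfield_Rats: "subfield \<rat> complex_field"
  by (rule subfield_complexI) auto

text \<open>Polynomials over the rationals that kill a are multiples of \<open>f\<close> and so kill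
  b; thus a can be sent to b, and the embedding extends to the whole splitting field.\<close>

lemma gal_transitive_action:
  assumes f: "Factorial_Ring.irreducible f"
  shows "transitive_action (gal (gen (complex_roots f))) (complex_roots f)
    (\<lambda>\<sigma>. restrict \<sigma> (complex_roots f))"
proof (intro transitive_action.intro transitive_action_axioms.intro)
  let ?R = "complex_roots f"
  have f0: "f \<noteq> 0" using f by auto
  note R = normal_gens_complex_roots[OF f0]
  show "group_action (gal (gen ?R)) ?R (\<lambda>\<sigma>. restrict \<sigma> ?R)"
    using gal_faithful_action[OF R] by (rule faithful_action.axioms)
  fix a b assume ab: "a \<in> ?R" "b \<in> ?R"
  have root: "poly (map_poly (\<lambda>x. x) p) b = 0" if p: "p \<in> polys_over \<rat>" "poly p a = 0" for p
  proof -
    \<comment> \<open>\<open>g\<close> undoes \<open>of_rat\<close>, turning a complex polynomial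
      with rational coefficients back into a rational one, to which irreducibility of
      \<open>f\<close> applies.\<close>
    define g where "g = inv_into UNIV (of_rat :: rat \<Rightarrow> complex)"
    have "g (of_rat 0) = 0" unfolding g_def by (rule inv_into_f_f) (auto intro: injI)
    then have "g 0 = 0" by simp
    moreover have "of_rat (g x) = x" if "x \<in> \<rat>" for x
      using that unfolding g_def Rats_def by (rule f_inv_into_f)
    ultimately have q: "p = map_poly of_rat (map_poly g p)" (is "_ = map_poly of_rat ?q")
      using p(1) by (intro poly_eqI) (simp add: coeff_map_poly polys_over_def)
    have "f dvd ?q"
      using p(2) q by (intro irreducible_dvd_if_common_root[OF f ab(1)]) (simp add: complex_roots_def)
    then obtain h where "?q = f * h" ..
    with q have "p = map_poly of_rat f * map_poly of_rat h" by (simp add: map_poly_of_rat_mult)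
    then show ?thesis using ab(2) by (simp add: complex_roots_def)
  qed
  have "(\<lambda>x. x) \<in> embeddings \<rat>" by (simp add: embeddings_iff)
  from extend_embedding_to[OF subfield_Rats this algebraic_over_complex_root[OF subfield_Rats f0 ab(1)] root]
  obtain \<tau> where \<tau>: "\<tau> \<in> embeddings (gen (insert a \<rat>))" "\<tau> a = b" by blast
  have "gen (insert a \<rat>) \<subseteq> gen ?R"
    using ab(1) Rats_subset_gen gen_superset by (intro gen_subset_gen) blast
  from gal_extend[OF R subfield_gen this \<tau>(1)] obtain \<sigma> where
    "\<sigma> \<in> carrier (gal (gen ?R))" "\<And>x. x \<in> gen (insert a \<rat>) \<Longrightarrow> \<sigma> x = \<tau> x" by blast
  then show "\<exists>\<sigma>\<in>carrier (gal (gen ?R)). restrict \<sigma> ?R a = b"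
    using \<tau>(2) ab(1) by (intro bexI[of _ \<sigma>]) (auto intro: generate_field.incl)
qed

section \<open>Complex conjugation and real roots\<close>

lemma cnj_complex_roots: "z \<in> complex_roots f \<Longrightarrow> cnj z \<in> complex_roots f"
proof -
  have "cnj (of_rat q) = of_rat q" for q
    by (cases q) (simp add: of_rat_rat)
  then have "map_poly cnj (map_poly of_rat f) = map_poly of_rat f"
    by (intro poly_eqI) (simp add: coeff_map_poly)
  moreover assume "z \<in> complex_roots f"
  ultimately show ?thesis
    using poly_cnj[of "map_poly of_rat f" z] by (simp add: complex_roots_def)
qed

lemma odd_card_ex_real_root:
  assumes "odd (card (complex_roots f))"
  shows "\<exists>z\<in>complex_roots f. z \<in> \<real>"
proof (rule ccontr)
  assume no_real: "\<not> ?thesis"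
  let ?R = "complex_roots f"
  let ?U = "{z \<in> ?R. Im z > 0}"
  have fin: "finite ?R" using assms by (cases "finite ?R") auto
  have "?R = ?U \<union> cnj ` ?U"
  proof (intro equalityI subsetI)
    fix z assume z: "z \<in> ?R"
    then have "Im z \<noteq> 0" using no_real by (auto simp: complex_is_Real_iff)
    then have "z \<in> ?U \<or> cnj z \<in> ?U" using z cnj_complex_roots by auto
    then show "z \<in> ?U \<union> cnj ` ?U" using image_eqI[of z cnj "cnj z" ?U] by auto
  qed (auto intro: cnj_complex_roots)
  then have "card ?R = card (?U \<union> cnj ` ?U)" by (rule arg_cong)
  also have "\<dots> = card ?U + card (cnj ` ?U)" using fin by (intro card_Un_disjoint) auto
  also have "card (cnj ` ?U) = card ?U" by (intro card_image inj_onI) simp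
  finally have "card ?R = card ?U + card ?U" .
  with assms show False by simp
qed

theorem corollary1:
  fixes p :: nat and f :: "rat poly"
  assumes "Factorial_Ring.prime p" and "p \<ge> 5"
    and "Factorial_Ring.irreducible f" and "Polynomial.degree f = p"
    and "\<exists>z. z \<notin> \<real> \<and> z \<in> complex_roots f \<and> cnj z \<in> complex_roots f"
    and "solvable_by_radicals f"
  shows "frobenius_group (galois_group complex_field \<rat> (splitting_field f)) (complex_roots f)
           (\<lambda>\<sigma>. restrict \<sigma> (complex_roots f)) \<and>
         card (complex_roots f) = p \<and>
         (\<exists>!z. z \<in> complex_roots f \<and> z \<in> \<real>)"
proof -
  let ?R = "complex_roots f" and ?\<phi> = "\<lambda>\<sigma>. restrict \<sigma> (complex_roots f)"
  let ?G = "gal (gen ?R)"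
  have f0: "f \<noteq> 0" using assms(3) by auto
  note R = normal_gens_complex_roots[OF f0]
  have card: "card ?R = p" using card_complex_roots[OF assms(3)] assms(2,4) by simp
  note actions = gal_faithful_action[OF R] gal_transitive_action[OF assms(3)]
  obtain n where "(derived ?G ^^ n) (carrier ?G) = {\<one>\<^bsub>?G\<^esub>}"
    using solvable_by_radicals_derived_series[OF f0 assms(6)] unfolding splitting_field_eq_gen .
  then have stab: "stabilizer ?G ?\<phi> a \<inter> stabilizer ?G ?\<phi> b = {\<one>\<^bsub>?G\<^esub>}"
    if "a \<in> ?R" "b \<in> ?R" "a \<noteq> b" for a b
    using solvable_prime_degree_stabilizers[OF actions _ _ that] card assms(1) by blast
  define \<kappa> where "\<kappa> = restrict cnj (gen ?R)"
  have \<kappa>: "\<kappa> \<in> carrier ?G"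
    unfolding \<kappa>_def by (intro restrict_embedding_in_gal R) (simp add: embeddings_iff)
  \<comment> \<open>Conjugation stabilizes every real root and moves w: a second real root would
    contradict \<open>stab\<close>, and a single one already has a nontrivial stabilizer.\<close>
  have \<kappa>_stab: "\<kappa> \<in> stabilizer ?G ?\<phi> z" if "z \<in> ?R" "z \<in> \<real>" for z
    using that \<kappa> by (simp add: stabilizer_def \<kappa>_def generate_field.incl Reals_cnj_iff)
  obtain w where w: "w \<in> ?R" "w \<notin> \<real>" using assms(5) by blast
  have "\<kappa> w \<noteq> \<one>\<^bsub>?G\<^esub> w"
    using w by (simp add: \<kappa>_def one_gal generate_field.incl Reals_cnj_iff)
  then have \<kappa>_one: "\<kappa> \<noteq> \<one>\<^bsub>?G\<^esub>" by auto
  have "odd p" using assms(1,2) by (intro prime_odd_nat) auto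
  then obtain r where r: "r \<in> ?R" "r \<in> \<real>" using odd_card_ex_real_root[of f] card by auto
  have "frobenius_group ?G ?R ?\<phi>"
  proof (intro frobenius_group.intro actions frobenius_group_axioms.intro stab)
    show "\<exists>\<alpha>\<in>?R. stabilizer ?G ?\<phi> \<alpha> \<noteq> {\<one>\<^bsub>?G\<^esub>}"
      using \<kappa>_stab[OF r] \<kappa>_one r(1) by blast
  qed
  moreover have "\<exists>!z. z \<in> ?R \<and> z \<in> \<real>"
    using r stab \<kappa>_stab \<kappa>_one by blast
  ultimately show ?thesis using card unfolding splitting_field_eq_gen by blast
qed

end
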